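(* Let $\{x^k\}_{k\ge1}$ be generated by the block prox-linear (BPL) method described in the context (under Assumptions 1, 2 and 3 stated there), and suppose the weights $\omega_k$ are chosen so that $F(x^k)\le F(x^{k-1})$ for all $k$. Assume that $\{x^k\}_{k\ge1}$ has a finite limit point $\bar x$; that $F$ satisfies the Kurdyka-Łojasiewicz (KL) property at $\bar x$ with parameters $\rho$, $\eta$ and $\theta$; and that for each $i$, $\nabla_{x_i}f(x)$ is Lipschitz continuous within $\mathcal{B}_{4\rho}(\bar x)$ with respect to $x$. Then: 1. If $\theta\in[0,\frac12]$, then $\|x^k-\bar x\|\le C\alpha^k$ for all $k$, for a certain $C>0$ and $\alpha\in[0,1)$. 2. If $\theta\in(\frac12,1)$, then $\|x^k-\bar x\|\le Ck^{-(1-\theta)/(2\theta-1)}$ for all $k$, for a certain $C>0$.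
   Context: Problem: minimize $F(x)=f(x_1,\dots,x_s)+\sum_{i=1}^s r_i(x_i)$ over $x=(x_1,\dots,x_s)\in\mathbb{R}^n$ ($s\ge1$ blocks), with Euclidean norm $\|\cdot\|$. No convexity is assumed. Assumption 1: $f$ is (real-valued and) continuously differentiable; each $r_i$ is proper lower semicontinuous with values in $(-\infty,+\infty]$; $F$ is proper and bounded below on $\mathrm{dom}(F)=\{x:F(x)<+\infty\}$; there is $x^*$ with $0\in\partial F(x^* )$. Subdifferential: $g\in\hat\partial F(x)$ for $x\in\mathrm{dom}(F)$ if $\liminf_{y\to x,\,y\ne x}\frac{F(y)-F(x)-\langle g,y-x\rangle}{\|y-x\|}\ge0$; $\hat\partial F(x)=\emptyset$ for $x\notin\mathrm{dom}(F)$. The limiting subdifferential is $\partial F(x)=\{g:\exists\,x_m\to x,\ g_m\in\hat\partial F(x_m),\ g_m\to g\}$. BPL method: start from $x^{-1}=x^0$. At iteration $k=1,2,\dots$ a block $b_k\in\{1,\dots,s\}$ is picked; for $i\ne b_k$ set $x_i^k=x_i^{k-1}$; for $i=b_k$ choose $$x_i^k\in\arg\min_{x_i}\ \langle\nabla_{x_i}f(x_{\ne i}^{k-1},\hat x_i^k),x_i-\hat x_i^k\rangle+\frac1{2\alpha_k}\|x_i-\hat x_i^k\|^2+r_i(x_i),\qquad \hat x_i^k=x_i^{k-1}+\omega_k(x_i^{k-1}-x_i^{\mathrm{prev}}),$$ where $(x_{\neq i}^{k-1},u)$ denotes $x^{k-1}$ with its $i$-th block replaced by $u$, $0\le\omega_k\le1$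 is an extrapolation weight and $x_i^{\mathrm{prev}}$ is the value of block $i$ before it was updated to $x_i^{k-1}$. Assumption 2: for $i=b_k$, $u\mapsto\nabla_{x_i}f(x_{\ne i}^{k-1},u)$ is Lipschitz with constant $L_k$, and $0<\ell\le L_k\le L<\infty$ for all $k$. Assumption 3: within any $T$ consecutive iterations every block is updated at least once. Parameter choice: let $\tilde L_i^j$ and $\tilde\omega_i^j$ be the values of $L_k$ and $\omega_k$ at the iteration $k$ of the $j$-th update of block $i$ ($\tilde L_i^0>0$ is an arbitrary fixed number). Then $\alpha_k=\frac{1}{2L_k}$ for all $k$ and $\tilde\omega_i^j\le\frac{\delta}{6}\sqrt{\tilde L_i^{j-1}/\tilde L_i^{j}}$ for all $i,j$, for some $0\le\delta<1$. KL property: $\psi$ satisfies the KL property at $\bar x\in\mathrm{dom}(\partial\psi)=\{x:\partial\psi(x)\ne\emptyset\}$ with parameters $\rho,\eta,\theta$ if $\rho,\eta>0$, $\theta\in[0,1)$ and there is $c>0$ such that, with $\phi(a)=c\,a^{1-\theta}$, $$\phi'(|\psi(x)-\psi(\bar x)|)\,\mathrm{dist}(0,\partial\psi(x))\ge1\quad\text{for all }x\in\mathcal{B}_\rho(\bar x)\cap\mathrm{dom}(\partial\psi)\text{ with }\psi(\bar x)<\psi(x)<\psi(\bar x)+\eta,$$ where $\mathcal{B}_\rho(\bar x)=\{x:\|x-\bar x\|<\rho\}$ and $\mathrm{dist}(0,\partial\psi(x))=\min\{\|y\|:y\in\partial\psi(x)\}$. *)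

theory Defs
  imports "HOL-Analysis.Analysis"
begin

section \<open>Block structure\<close>

text \<open>
  Blocks may have different sizes, so the partition of the coordinates of
  \<open>real ^ 'n\<close> into blocks indexed by \<open>'s\<close> is a map \<open>p :: 'n \<Rightarrow> 's\<close> sending a
  coordinate to its block. The space of the \<open>i\<close>-th block variable is the coordinate
  subspace \<open>block_space p i\<close> of \<open>real ^ 'n\<close>, with the inherited Euclidean norm, and
  \<open>x\<^sub>i\<close> is \<open>block_proj p i x\<close>. A function of the \<open>i\<close>-th block is represented by a
  function on \<open>real ^ 'n\<close> of which only the values on \<open>block_space p i\<close> are used.
\<close>

definition block_proj :: "('n \<Rightarrow> 's) \<Rightarrow> 's \<Rightarrow> real ^ 'n \<Rightarrow> real ^ 'n::finite" where
  "block_proj p i x = (\<chi> j. if p j = i then x $ j else 0)"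

definition block_space :: "('n \<Rightarrow> 's) \<Rightarrow> 's \<Rightarrow> (real ^ 'n::finite) set" where
  "block_space p i = {u. \<forall>j. p j \<noteq> i \<longrightarrow> u $ j = 0}"

text \<open>The point \<open>(x\<^bsub>\<noteq>i\<^esub>, u)\<close>.\<close>

definition block_subst ::
    "('n \<Rightarrow> 's) \<Rightarrow> 's \<Rightarrow> real ^ 'n \<Rightarrow> real ^ 'n \<Rightarrow> real ^ 'n::finite" where
  "block_subst p i x u = (\<chi> j. if p j = i then u $ j else x $ j)"

definition objective ::
    "('n \<Rightarrow> 's::finite) \<Rightarrow> (real ^ 'n::finite \<Rightarrow> real) \<Rightarrow> ('s \<Rightarrow> real ^ 'n \<Rightarrow> ereal)
      \<Rightarrow> real ^ 'n \<Rightarrow> ereal" where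
  "objective p f r x = ereal (f x) + (\<Sum>i\<in>UNIV. r i (block_proj p i x))"

section \<open>Extended-valued functions and subdifferentials\<close>

definition proper_on :: "'a set \<Rightarrow> ('a \<Rightarrow> ereal) \<Rightarrow> bool" where
  "proper_on S g \<longleftrightarrow> (\<forall>u\<in>S. g u \<noteq> -\<infinity>) \<and> (\<exists>u\<in>S. g u < \<infinity>)"

definition lsc_on :: "'a::topological_space set \<Rightarrow> ('a \<Rightarrow> ereal) \<Rightarrow> bool" where
  "lsc_on S g \<longleftrightarrow> (\<forall>u\<in>S. g u \<le> Liminf (at u within S) g)"

definition eff_dom :: "('a \<Rightarrow> ereal) \<Rightarrow> 'a set" where
  "eff_dom \<psi> = {x. \<psi> x < \<infinity>}"

definition frechet_subdiff :: "('a::euclidean_space \<Rightarrow> ereal) \<Rightarrow> 'a \<Rightarrow> 'a set" where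
  "frechet_subdiff \<psi> x =
    {g. x \<in> eff_dom \<psi> \<and>
        Liminf (at x) (\<lambda>y. (\<psi> y - \<psi> x - ereal (g \<bullet> (y - x))) / ereal (norm (y - x))) \<ge> 0}"

text \<open>Convergence of the function values \<open>\<psi> (X m)\<close> to \<open>\<psi> x\<close> is not required.\<close>

definition limiting_subdiff :: "('a::euclidean_space \<Rightarrow> ereal) \<Rightarrow> 'a \<Rightarrow> 'a set" where
  "limiting_subdiff \<psi> x =
    {g. \<exists>X G. X \<longlonglongrightarrow> x \<and> (\<forall>m. G m \<in> frechet_subdiff \<psi> (X m)) \<and> G \<longlonglongrightarrow> g}"

definition dom_subdiff :: "('a::euclidean_space \<Rightarrow> ereal) \<Rightarrow> 'a set" where
  "dom_subdiff \<psi> = {x. limiting_subdiff \<psi> x \<noteq> {}}"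

definition KL_property ::
    "('a::euclidean_space \<Rightarrow> ereal) \<Rightarrow> 'a \<Rightarrow> real \<Rightarrow> real \<Rightarrow> real \<Rightarrow> bool" where
  "KL_property \<psi> xbar \<rho> \<eta> \<theta> \<longleftrightarrow>
    xbar \<in> dom_subdiff \<psi> \<and> \<rho> > 0 \<and> \<eta> > 0 \<and> 0 \<le> \<theta> \<and> \<theta> < 1 \<and>
    (\<exists>c>0. \<forall>x \<in> ball xbar \<rho> \<inter> dom_subdiff \<psi>.
       \<psi> xbar < \<psi> x \<and> \<psi> x < \<psi> xbar + ereal \<eta> \<longrightarrow>
       deriv (\<lambda>a. c * a powr (1 - \<theta>)) \<bar>real_of_ereal (\<psi> x - \<psi> xbar)\<bar>
         * infdist 0 (limiting_subdiff \<psi> x) \<ge> 1)"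

section \<open>The block prox-linear method\<close>

text \<open>
  Iterations are numbered from 1: \<open>b k\<close> is the block updated at iteration \<open>k \<ge> 1\<close>, and
  \<open>x 0\<close> is the starting point. \<open>prev_iterate b x k i\<close> is an iterate whose \<open>i\<close>-th block is
  the value before block \<open>i\<close> was last updated prior to iteration \<open>k\<close>; if it has not been
  updated yet, this is the value at \<open>x\<^sup>-\<^sup>1 = x\<^sup>0\<close>.
\<close>

definition prev_iterate :: "(nat \<Rightarrow> 's) \<Rightarrow> (nat \<Rightarrow> 'a) \<Rightarrow> nat \<Rightarrow> 's \<Rightarrow> 'a" where
  "prev_iterate b x k i =
    (let M = {m. 1 \<le> m \<and> m < k \<and> b m = i} in if M = {} then x 0 else x (Max M - 1))"

definition extrapolated ::
    "('n \<Rightarrow> 's) \<Rightarrow> (nat \<Rightarrow> 's) \<Rightarrow> (nat \<Rightarrow> real) \<Rightarrow> (nat \<Rightarrow> real ^ 'n) \<Rightarrow> nat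
      \<Rightarrow> real ^ 'n::finite" where
  "extrapolated p b \<omega> x k =
    block_proj p (b k) (x (k - 1)) +
    \<omega> k *\<^sub>R (block_proj p (b k) (x (k - 1)) - block_proj p (b k) (prev_iterate b x k (b k)))"

text \<open>Here \<open>gradf\<close> is the full gradient of the smooth part, so that its \<open>i\<close>-th block
  \<open>block_proj p i (gradf x)\<close> is the partial gradient with respect to the \<open>i\<close>-th block.\<close>

definition BPL_sequence ::
    "('n \<Rightarrow> 's) \<Rightarrow> (real ^ 'n \<Rightarrow> real ^ 'n) \<Rightarrow> ('s \<Rightarrow> real ^ 'n::finite \<Rightarrow> ereal)
      \<Rightarrow> (nat \<Rightarrow> 's) \<Rightarrow> (nat \<Rightarrow> real) \<Rightarrow> (nat \<Rightarrow> real) \<Rightarrow> (nat \<Rightarrow> real ^ 'n) \<Rightarrow> bool" where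
  "BPL_sequence p gradf r b \<omega> \<alpha> x \<longleftrightarrow>
    (\<forall>k\<ge>1.
      (\<forall>i. i \<noteq> b k \<longrightarrow> block_proj p i (x k) = block_proj p i (x (k - 1))) \<and>
      (let i = b k; xhat = extrapolated p b \<omega> x k in
        is_arg_min
          (\<lambda>u. ereal (block_proj p i (gradf (block_subst p i (x (k - 1)) xhat)) \<bullet> (u - xhat)
                      + 1 / (2 * \<alpha> k) * (norm (u - xhat))\<^sup>2) + r i u)
          (\<lambda>u. u \<in> block_space p i)
          (block_proj p i (x k))))"

text \<open>The iteration at which block \<open>i\<close> is updated for the \<open>j\<close>-th time, \<open>j \<ge> 1\<close>
  (meaningful when block \<open>i\<close> is updated infinitely often).\<close>

definition update_iter :: "(nat \<Rightarrow> 's) \<Rightarrow> 's \<Rightarrow> nat \<Rightarrow> nat" where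
  "update_iter b i j = enumerate {k. 1 \<le> k \<and> b k = i} (j - 1)"

text \<open>The value at the \<open>j\<close>-th update of block \<open>i\<close> of a parameter \<open>a\<close> indexed by
  iterations, with a given initial value for \<open>j = 0\<close>.\<close>

definition at_update :: "(nat \<Rightarrow> 's) \<Rightarrow> (nat \<Rightarrow> real) \<Rightarrow> ('s \<Rightarrow> real) \<Rightarrow> 's \<Rightarrow> nat \<Rightarrow> real" where
  "at_update b a a0 i j = (if j = 0 then a0 i else a (update_iter b i j))"

end

theory Submission
  imports Defs
begin

text \<open>
  Let \<open>e\<^sub>i\<close> be the latest step of block \<open>i\<close> and \<open>\<Lambda>\<^sub>i\<close> the Lipschitz constant used for it. The
  extrapolation terms are absorbed by the potential
  \<open>\<Phi> = F - F(xbar) + \<beta> \<Sum>\<^sub>i \<Lambda>\<^sub>i |e\<^sub>i|\<^sup>2 / 4\<close>, which decreases at every iteration by a multiple of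
  \<open>q\<^sup>2\<close>, where \<open>q\<close> adds the length of the new step and that of the previous step of the same block.
  Over a window of \<open>T\<close> iterations all blocks are updated, so some subgradient of \<open>F\<close> at the last
  iterate, and the square root of the energy, are at most a multiple of the sum of \<open>q\<close> over the
  window. With \<open>\<theta>' = max \<theta> (1/2)\<close> (the exponent may be raised where \<open>F - F(xbar) \<le> 1\<close>, and
  exponents below \<open>1/2\<close> would not control the energy) the KL inequality then bounds
  \<open>\<Phi> powr \<theta>'\<close> by that sum. Concavity of \<open>t powr (1 - \<theta>')\<close> makes the remaining path length at most a
  multiple of \<open>\<Phi> powr (1 - \<theta>')\<close>, which keeps the iterates in the KL neighbourhood and reduces the
  claim to the scalar recursion \<open>\<Phi>\<^sub>k\<^sub>+\<^sub>T powr (2 \<theta>') \<le> C (\<Phi>\<^sub>k - \<Phi>\<^sub>k\<^sub>+\<^sub>T)\<close>.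
\<close>

section \<open>Descent sequences with an error bound\<close>

text \<open>Concavity of \<open>s powr (1 - t)\<close>: its graph lies below the tangent at
  \<open>u\<close>. The derivative rule for \<open>powr\<close> needs a positive base, so
  \<open>v = 0\<close> is treated apart.\<close>

lemma powr_concave_diff:
  fixes u v t :: real
  assumes "0 < u" "0 \<le> v" "v \<le> u" "0 \<le> t" "t < 1"
  shows "(1 - t) * u powr (- t) * (u - v) \<le> u powr (1 - t) - v powr (1 - t)"
proof (cases "v = 0")
  case True
  have "u powr (- t) * u = u powr (1 - t)"
    using assms by (simp add: powr_diff powr_minus field_simps)
  then have "(1 - t) * u powr (- t) * (u - v) = (1 - t) * u powr (1 - t)"
    using True by (simp add: mult.assoc)
  also have "\<dots> \<le> 1 * u powr (1 - t)"
    using assms by (intro mult_right_mono) auto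
  finally show ?thesis using True by simp
next
  case False
  then have v: "0 < v" using assms by simp
  show ?thesis
  proof (cases "v = u")
    case False
    then have "v < u" using assms by simp
    have "\<exists>z. v < z \<and> z < u \<and> u powr (1 - t) - v powr (1 - t) = (u - v) * ((1 - t) * z powr (1 - t - 1))"
      by (rule MVT2[OF \<open>v < u\<close>], rule has_real_derivative_powr) (use v in linarith)
    then obtain z where z: "v < z" "z < u"
      "u powr (1 - t) - v powr (1 - t) = (u - v) * ((1 - t) * z powr (- t))" by auto
    have "u powr (- t) \<le> z powr (- t)"
      using z v assms by (intro powr_mono2') auto
    then have "(u - v) * ((1 - t) * u powr (- t)) \<le> (u - v) * ((1 - t) * z powr (- t))"
      using assms by (intro mult_left_mono) auto
    then show ?thesis using z by (simp add: mult_ac)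
  qed simp
qed

text \<open>Convexity of \<open>u powr (- p)\<close>, via the mean value theorem. It measures the
  gap between consecutive terms of the sublinear bound.\<close>

lemma powr_neg_diff_bound:
  fixes u h :: real
  assumes "0 < u" "0 < h" "0 < p"
  shows "u powr (- p) - (u + h) powr (- p) \<le> h * (p * u powr (- p - 1))"
proof -
  have "\<exists>z. u < z \<and> z < u + h \<and> (u + h) powr (- p) - u powr (- p) = (u + h - u) * ((- p) * z powr (- p - 1))"
    by (rule MVT2, use assms in linarith, rule has_real_derivative_powr) (use assms in linarith)
  then obtain z where z: "u < z"
      "(u + h) powr (- p) - u powr (- p) = h * ((- p) * z powr (- p - 1))" by auto
  have "z powr (- p - 1) \<le> u powr (- p - 1)"
    using z assms by (intro powr_mono2') auto
  then have "h * (p * z powr (- p - 1)) \<le> h * (p * u powr (- p - 1))"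
    using assms by (intro mult_left_mono) auto
  then show ?thesis using z by simp
qed

lemma geometric_decay:
  fixes y :: "nat \<Rightarrow> real"
  assumes "\<And>m. y (Suc m) \<le> g * y m" "0 \<le> g"
  shows "y m \<le> g ^ m * y 0"
proof (induction m)
  case (Suc m)
  have "y (Suc m) \<le> g * y m" by fact
  also have "\<dots> \<le> g * (g ^ m * y 0)" using Suc assms by (intro mult_left_mono)
  finally show ?case by simp
qed simp

text \<open>Induction with the candidate bound \<open>B * (m + 1) powr (- p)\<close>,
  \<open>p = 1 / \<nu>\<close>. If the next term exceeded its bound, the left side of the recursion
  would exceed \<open>B powr (1 + \<nu>) * (M + 1) powr (- p - 1)\<close>, while the gap between two
  consecutive bounds on the right is only linear in \<open>B\<close>; a large \<open>B\<close> makes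
  this contradictory.\<close>

lemma sublinear_decay:
  fixes y :: "nat \<Rightarrow> real"
  assumes rec: "\<And>m. y (Suc m) powr (1 + \<nu>) \<le> c * (y m - y (Suc m))"
    and nonneg: "\<And>m. 0 \<le> y m" and "0 < \<nu>" "0 < c"
  obtains B where "0 < B" "\<And>m. y m \<le> B * real (m + 1) powr (- (1 / \<nu>))"
proof -
  define p where "p = 1 / \<nu>"
  have p: "0 < p" "p * (1 + \<nu>) = p + 1" using assms by (auto simp: p_def field_simps)
  \<comment> \<open>The first entry starts the induction and makes \<open>B\<close> positive; the
    second yields \<open>c * p * 2 powr (p + 1) \<le> B powr \<nu>\<close>, which closes it.\<close>
  define B where "B = max (y 0 + 1) ((c * p * 2 powr (p + 1)) powr p)"
  have B: "0 < B" "y 0 \<le> B" using nonneg[of 0] by (auto simp: B_def)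
  have "c * p * 2 powr (p + 1) = ((c * p * 2 powr (p + 1)) powr p) powr \<nu>"
    using assms p by (simp add: powr_powr p_def)
  also have "\<dots> \<le> B powr \<nu>"
    using assms by (intro powr_mono2) (auto simp: B_def)
  finally have B\<nu>: "c * p * 2 powr (p + 1) \<le> B powr \<nu>" .
  have "y m \<le> B * real (m + 1) powr (- p)" for m
  proof (induction m)
    case 0
    show ?case using B by simp
  next
    case (Suc m)
    show ?case
    proof (rule ccontr)
      define M where "M = real (m + 1)"
      assume "\<not> y (Suc m) \<le> B * real (Suc m + 1) powr (- p)"
      then have gt: "B * (M + 1) powr (- p) < y (Suc m)"
        by (simp add: M_def algebra_simps)
      have M: "1 \<le> M" by (simp add: M_def)
      have IH: "y m \<le> B * M powr (- p)" using Suc by (simp add: M_def)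
      have "(B * (M + 1) powr (- p)) powr (1 + \<nu>) < y (Suc m) powr (1 + \<nu>)"
        using gt B assms M by (intro powr_less_mono2) auto
      also have "\<dots> \<le> c * (y m - y (Suc m))" by (rule rec)
      also have "\<dots> < c * (B * M powr (- p) - B * (M + 1) powr (- p))"
        using gt IH assms by (intro mult_strict_left_mono) auto
      also have "\<dots> = c * (B * (M powr (- p) - (M + 1) powr (- p)))" by (simp add: algebra_simps)
      also have "\<dots> \<le> c * (B * (1 * (p * M powr (- p - 1))))"
        using powr_neg_diff_bound[of M 1 p] M p B assms by (intro mult_left_mono) auto
      also have "\<dots> = B * (c * p * M powr (- p - 1))" by simp
      \<comment> \<open>Passing from \<open>M\<close> to \<open>M + 1\<close> costs the factor
        \<open>2 powr (p + 1)\<close>, since \<open>M + 1 \<le> 2 * M\<close>.\<close>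
      also have "M powr (- p - 1) \<le> 2 powr (p + 1) * (M + 1) powr (- p - 1)"
      proof -
        have "(M + 1) powr (p + 1) \<le> (2 * M) powr (p + 1)"
          using M p by (intro powr_mono2) auto
        also have "\<dots> = 2 powr (p + 1) * M powr (p + 1)" using M by (simp add: powr_mult)
        finally have "inverse (M powr (p + 1)) \<le> 2 powr (p + 1) * inverse ((M + 1) powr (p + 1))"
          using M by (simp add: field_simps)
        moreover have "- p - 1 = - (p + 1)" by simp
        ultimately show ?thesis by (simp only: powr_minus)
      qed
      then have "B * (c * p * M powr (- p - 1)) \<le> B * (c * p * (2 powr (p + 1) * (M + 1) powr (- p - 1)))"
        using B assms p by (intro mult_left_mono) auto
      also have "\<dots> = B * ((c * p * 2 powr (p + 1)) * (M + 1) powr (- p - 1))" by simp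
      also have "\<dots> \<le> B * (B powr \<nu> * (M + 1) powr (- p - 1))"
        using B B\<nu> by (intro mult_left_mono mult_right_mono) auto
      also have "\<dots> = (B * (M + 1) powr (- p)) powr (1 + \<nu>)"
      proof -
        have "(B * (M + 1) powr (- p)) powr (1 + \<nu>) = B powr (1 + \<nu>) * (M + 1) powr (- p * (1 + \<nu>))"
          using B M by (simp add: powr_mult powr_powr)
        also have "- p * (1 + \<nu>) = - p - 1" using p by simp
        also have "B powr (1 + \<nu>) = B * B powr \<nu>" using B by (simp add: powr_add)
        finally show ?thesis by simp
      qed
      finally show False by simp
    qed
  qed
  then show ?thesis using that B by (simp add: p_def)
qed

section \<open>Splitting indices into windows of length \<open>T\<close>; early indices\<close>

lemma window_index:
  fixes k K T :: nat
  assumes "0 < T" "K \<le> k"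
  shows "K + T * ((k - K) div T) \<le> k" "k \<le> K + T * ((k - K) div T) + T"
proof -
  have "T * ((k - K) div T) + (k - K) mod T = k - K" by simp
  moreover have "(k - K) mod T < T" using assms by simp
  ultimately show "K + T * ((k - K) div T) \<le> k" "k \<le> K + T * ((k - K) div T) + T"
    using assms by linarith+
qed

lemma le_window_index:
  fixes k K T :: nat
  assumes "0 < T" "K \<le> k"
  shows "k \<le> K + T * (k - K)"
proof -
  have "1 * (k - K) \<le> T * (k - K)" using assms by (intro mult_le_mono1) simp
  then show ?thesis by linarith
qed

text \<open>The finitely many early indices are absorbed by adding their ratios
  \<open>|u k| / v k\<close> to the constant; this uses that \<open>v\<close> is positive.\<close>

lemma bound_from_some_index_on:
  fixes u v :: "nat \<Rightarrow> real"
  assumes "\<And>k. k \<ge> K \<Longrightarrow> u k \<le> C * v k" and pos: "\<And>k. k \<ge> 1 \<Longrightarrow> 0 < v k"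
  shows "\<exists>C>0. \<forall>k\<ge>1. u k \<le> C * v k"
proof (intro exI conjI allI impI)
  let ?D = "\<bar>C\<bar> + (\<Sum>k\<in>{1..K}. \<bar>u k\<bar> / v k) + 1"
  have nonneg: "0 \<le> (\<Sum>k\<in>{1..K}. \<bar>u k\<bar> / v k)"
    using pos by (intro sum_nonneg) (simp add: less_imp_le)
  then show "0 < ?D" by simp
  fix k :: nat assume k: "1 \<le> k"
  show "u k \<le> ?D * v k"
  proof (cases "K \<le> k")
    case True
    then have "u k \<le> C * v k" using assms by simp
    also have "\<dots> \<le> ?D * v k" using pos[OF k] nonneg by (intro mult_right_mono) auto
    finally show ?thesis .
  next
    case False
    have "\<bar>u k\<bar> / v k \<le> (\<Sum>k\<in>{1..K}. \<bar>u k\<bar> / v k)"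
      using pos k False by (intro member_le_sum) (auto simp: less_imp_le)
    then have "\<bar>u k\<bar> / v k \<le> ?D" by simp
    then have "\<bar>u k\<bar> \<le> ?D * v k" using pos[OF k] by (simp add: field_simps)
    then show ?thesis by simp
  qed
qed

section \<open>Abstract descent sequences: trapping and rates\<close>

text \<open>What the rates need from the algorithm, with no block structure left:
  \<open>\<Phi>\<close> is the potential and \<open>q\<close> dominates the steps. The error bound
  is assumed only for windows inside the ball, so the iterates must first be shown to stay
  there.\<close>

locale kl_descent =
  fixes x :: "nat \<Rightarrow> 'a::real_normed_vector" and xbar :: 'a
    and \<Phi> q :: "nat \<Rightarrow> real" and a c \<rho> \<theta> :: real and k0 T :: nat
  assumes a_pos: "0 < a" and c_nonneg: "0 \<le> c" and \<rho>_pos: "0 < \<rho>" and T_pos: "0 < T"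
    and \<theta>_range: "1 / 2 \<le> \<theta>" "\<theta> < 1"
    and \<Phi>_nonneg: "\<And>k. k \<ge> k0 \<Longrightarrow> 0 \<le> \<Phi> k" and \<Phi>_null: "\<Phi> \<longlonglongrightarrow> 0"
    and q_nonneg: "\<And>k. 0 \<le> q k"
    and decrease: "\<And>k. k \<ge> k0 \<Longrightarrow> a * (q (Suc k))\<^sup>2 \<le> \<Phi> k - \<Phi> (Suc k)"
    and step_le: "\<And>k. k \<ge> k0 \<Longrightarrow> dist (x (Suc k)) (x k) \<le> q (Suc k)"
    and error_bound: "\<And>k. k \<ge> k0 \<Longrightarrow> (\<And>j. j \<in> {k..k + T} \<Longrightarrow> x j \<in> ball xbar \<rho>) \<Longrightarrow>
          \<Phi> (k + T) powr \<theta> \<le> c * (\<Sum>j\<in>{k<..k + T}. q j)"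
    and cluster: "\<exists>\<sigma>. strict_mono \<sigma> \<and> (x \<circ> \<sigma>) \<longlonglongrightarrow> xbar"
begin

text \<open>The factor \<open>1 + c\<close> makes one estimate serve twice, for the path length of a
  window and for the right side of the error bound.\<close>

definition "A = (1 + c) * sqrt (real T / a)"

lemma A_pos: "0 < A"
  using a_pos c_nonneg T_pos by (simp add: A_def)

lemma \<Phi>_antimono: "k \<le> l \<Longrightarrow> k0 \<le> k \<Longrightarrow> \<Phi> l \<le> \<Phi> k"
proof (induction l rule: dec_induct)
  case (step l)
  have "0 \<le> a * (q (Suc l))\<^sup>2" using a_pos by simp
  then show ?case using decrease[of l] step by simp
qed simp

lemma sum_squares_le: "k0 \<le> k \<Longrightarrow> a * (\<Sum>j\<in>{k<..k + n}. (q j)\<^sup>2) \<le> \<Phi> k - \<Phi> (k + n)"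
proof (induction n)
  case (Suc n)
  have "{k<..k + Suc n} = insert (Suc (k + n)) {k<..k + n}" by auto
  then show ?case using Suc decrease[of "k + n"] by (simp add: algebra_simps)
qed simp

text \<open>Cauchy-Schwarz over the \<open>T\<close> terms of a window, combined with the telescoped
  decrease of \<open>\<Phi>\<close>.\<close>

lemma window_sum_le:
  assumes "k0 \<le> k"
  shows "(1 + c) * (\<Sum>j\<in>{k<..k + T}. q j) \<le> A * sqrt (\<Phi> k - \<Phi> (k + T))"
proof -
  have "(\<Sum>j\<in>{k<..k + T}. q j)\<^sup>2 \<le> (\<Sum>j\<in>{k<..k + T}. (q j)\<^sup>2) * T"
    using sum_squared_le_sum_of_squares[of q "{k<..k + T}"] by simp
  also have "\<dots> \<le> (\<Phi> k - \<Phi> (k + T)) / a * T"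
    using sum_squares_le[OF assms, of T] a_pos
    by (intro mult_right_mono) (simp_all add: field_simps)
  finally have "(\<Sum>j\<in>{k<..k + T}. q j) \<le> sqrt (real T / a * (\<Phi> k - \<Phi> (k + T)))"
    by (intro real_le_rsqrt) (simp add: field_simps)
  then have "(1 + c) * (\<Sum>j\<in>{k<..k + T}. q j) \<le> (1 + c) * sqrt (real T / a * (\<Phi> k - \<Phi> (k + T)))"
    using c_nonneg by (intro mult_left_mono) auto
  then show ?thesis by (simp only: A_def real_sqrt_mult mult.assoc)
qed

lemma dist_le_window_sum:
  assumes "k0 \<le> k" "j \<in> {k..k + n}"
  shows "dist (x j) (x k) \<le> (\<Sum>j\<in>{k<..k + n}. q j)"
proof -
  have "dist (x (k + m)) (x k) \<le> (\<Sum>j\<in>{k<..k + m}. q j)" for m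
  proof (induction m)
    case (Suc m)
    have "{k<..k + Suc m} = insert (Suc (k + m)) {k<..k + m}" by auto
    then show ?case
      using Suc step_le[of "k + m"] assms dist_triangle[of "x (k + Suc m)" "x k" "x (k + m)"] by simp
  qed simp
  from this[of "j - k"] have "dist (x j) (x k) \<le> (\<Sum>j\<in>{k<..j}. q j)" using assms by simp
  also have "\<dots> \<le> (\<Sum>j\<in>{k<..k + n}. q j)"
    using assms q_nonneg by (intro sum_mono2) auto
  finally show ?thesis .
qed

lemma window_dist:
  assumes "k0 \<le> k" "j \<in> {k..k + T}"
  shows "dist (x j) (x k) \<le> A * sqrt (\<Phi> k - \<Phi> (k + T))"
proof -
  have "0 \<le> c * (\<Sum>j\<in>{k<..k + T}. q j)" using c_nonneg q_nonneg by (simp add: sum_nonneg)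
  then show ?thesis
    using dist_le_window_sum[OF assms] window_sum_le[OF assms(1)] by (simp add: algebra_simps)
qed

lemma window_error_bound:
  assumes "k0 \<le> k" "\<And>j. j \<in> {k..k + T} \<Longrightarrow> x j \<in> ball xbar \<rho>"
  shows "\<Phi> (k + T) powr \<theta> \<le> A * sqrt (\<Phi> k - \<Phi> (k + T))"
proof -
  have "0 \<le> (\<Sum>j\<in>{k<..k + T}. q j)" using q_nonneg by (simp add: sum_nonneg)
  then show ?thesis
    using error_bound[OF assms] window_sum_le[OF assms(1)] by (simp add: algebra_simps)
qed

definition "B = A / (2 * (1 - \<theta>))"

lemma B_pos: "0 < B"
  using A_pos \<theta>_range by (simp add: B_def)

text \<open>Concavity gives \<open>(1 - \<theta>) * (u - v) \<le> D * u powr \<theta>\<close>, and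
  the error bound replaces \<open>u powr \<theta>\<close> by \<open>A * s\<close>. Only the first
  window has to lie in the ball, although the second one is estimated.\<close>

lemma window_step:
  assumes "k0 \<le> k" "\<And>j. j \<in> {k..k + T} \<Longrightarrow> x j \<in> ball xbar \<rho>"
  shows "sqrt (\<Phi> (k + T) - \<Phi> (k + T + T))
    \<le> sqrt (\<Phi> k - \<Phi> (k + T)) / 2 + B * (\<Phi> (k + T) powr (1 - \<theta>) - \<Phi> (k + T + T) powr (1 - \<theta>))"
proof -
  define u v s where "u = \<Phi> (k + T)" and "v = \<Phi> (k + T + T)" and "s = sqrt (\<Phi> k - u)"
  define D where "D = u powr (1 - \<theta>) - v powr (1 - \<theta>)"
  have uv: "0 \<le> v" "v \<le> u" "0 \<le> s"
    using assms \<Phi>_nonneg \<Phi>_antimono by (auto simp: u_def v_def s_def)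
  have D: "0 \<le> D" using uv \<theta>_range by (auto simp: D_def intro: powr_mono2)
  have eb: "u powr \<theta> \<le> A * s" using window_error_bound[OF assms] by (simp add: u_def s_def)
  have "u - v \<le> s * (2 * B * D)"
  proof (cases "u = 0")
    case False
    then have u: "0 < u" using uv by simp
    have "(1 - \<theta>) * u powr (- \<theta>) * (u - v) \<le> D"
      unfolding D_def using u uv \<theta>_range by (intro powr_concave_diff) auto
    then have "(1 - \<theta>) * (u - v) \<le> D * u powr \<theta>"
      using u by (simp add: powr_minus field_simps)
    also have "\<dots> \<le> D * (A * s)" using D eb by (intro mult_left_mono)
    finally show ?thesis using \<theta>_range by (simp add: B_def field_simps)
  qed (use uv D B_pos in auto)
  \<comment> \<open>Arithmetic-geometric mean inequality for \<open>s\<close> and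
    \<open>2 * B * D\<close>. The factor left on the previous window is \<open>1 / 2 < 1\<close>, so
    the estimates can be summed.\<close>
  also have "\<dots> \<le> (s / 2 + B * D)\<^sup>2"
    using sum_squares_ge_zero[of "s / 2 - B * D" 0] by (simp add: power2_eq_square algebra_simps)
  finally have "sqrt (u - v) \<le> s / 2 + B * D"
    using uv D B_pos by (intro real_le_lsqrt) auto
  then show ?thesis by (simp add: u_def v_def s_def D_def)
qed

text \<open>The powers telescope, and half of the sum is absorbed by the left side. The last window
  of the sum begins where the ball hypothesis ends.\<close>

lemma window_sum_bound:
  assumes "k0 \<le> K" "\<And>j. j \<in> {K..K + T * M} \<Longrightarrow> x j \<in> ball xbar \<rho>"
  shows "(\<Sum>m\<le>M. sqrt (\<Phi> (K + T * m) - \<Phi> (K + T * m + T)))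
    \<le> 2 * sqrt (\<Phi> K) + 2 * B * \<Phi> K powr (1 - \<theta>)"
proof -
  define s where "s m = sqrt (\<Phi> (K + T * m) - \<Phi> (K + T * m + T))" for m
  define D where "D m = \<Phi> (K + T * m) powr (1 - \<theta>)" for m
  have s_nonneg: "0 \<le> s m" for m
    unfolding s_def using assms by (auto intro!: \<Phi>_antimono)
  have step: "s (Suc m) \<le> s m / 2 + B * (D (Suc m) - D (Suc (Suc m)))" if "m < M" for m
  proof -
    have "T * m + T \<le> T * M" using that by (metis Suc_leI mult.commute mult_Suc add.commute mult_le_mono1)
    then have "x j \<in> ball xbar \<rho>" if "j \<in> {K + T * m..K + T * m + T}" for j
      using that assms(2)[of j] by auto
    from window_step[of "K + T * m", OF _ this] show ?thesis using assms
      by (simp add: s_def D_def algebra_simps)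
  qed
  have "(\<Sum>m<M. s (Suc m)) \<le> (\<Sum>m<M. s m / 2 + B * (D (Suc m) - D (Suc (Suc m))))"
    using step by (intro sum_mono) auto
  also have "\<dots> = (\<Sum>m<M. s m) / 2 + B * (D 1 - D (Suc M))"
    using sum_lessThan_telescope'[of "\<lambda>m. D (Suc m)" M]
    by (simp add: sum.distrib sum_divide_distrib flip: sum_distrib_left)
  also have "\<dots> \<le> (\<Sum>m\<le>M. s m) / 2 + B * D 0"
  proof (intro add_mono mult_left_mono)
    have "D 1 \<le> D 0" unfolding D_def
      using assms \<theta>_range by (intro powr_mono2 \<Phi>_antimono \<Phi>_nonneg) auto
    then show "D 1 - D (Suc M) \<le> D 0" unfolding D_def by (smt (verit) powr_ge_zero)
    show "(\<Sum>m<M. s m) / 2 \<le> (\<Sum>m\<le>M. s m) / 2"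
      using s_nonneg by (intro divide_right_mono sum_mono2) auto
  qed (use B_pos in auto)
  finally have "(\<Sum>m<M. s (Suc m)) \<le> (\<Sum>m\<le>M. s m) / 2 + B * D 0" .
  moreover have "(\<Sum>m\<le>M. s m) = s 0 + (\<Sum>m<M. s (Suc m))"
    by (simp add: sum.atMost_shift)
  moreover have "s 0 \<le> sqrt (\<Phi> K)"
    using assms \<Phi>_nonneg[of "K + T"] by (simp add: s_def)
  ultimately have "(\<Sum>m\<le>M. s m) \<le> 2 * sqrt (\<Phi> K) + 2 * (B * D 0)" by linarith
  then show ?thesis by (simp add: s_def D_def)
qed

text \<open>Bound for the length of the remaining path in terms of the current potential
  \<open>t\<close>.\<close>

definition "G t = A * (2 * sqrt t + 2 * B * t powr (1 - \<theta>))"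

text \<open>The conclusion reaches one window further than the ball hypothesis; this gain drives the
  induction in \<open>trapped\<close>.\<close>

lemma travel_bound:
  assumes "k0 \<le> K" "\<And>j. j \<in> {K..K + T * M} \<Longrightarrow> x j \<in> ball xbar \<rho>"
    and j: "j \<in> {K..K + T * M + T}"
  shows "dist (x j) (x K) \<le> G (\<Phi> K)"
proof -
  have "dist (x j) (x K) \<le> (\<Sum>m\<le>n. A * sqrt (\<Phi> (K + T * m) - \<Phi> (K + T * m + T)))"
    if "j \<in> {K + T * n..K + T * n + T}" for j n
    using that
  proof (induction n arbitrary: j)
    case 0
    then show ?case using window_dist[of K j] assms by simp
  next
    case (Suc n)
    have "dist (x j) (x (K + T * Suc n)) \<le> A * sqrt (\<Phi> (K + T * Suc n) - \<Phi> (K + T * Suc n + T))"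
      using Suc.prems assms by (intro window_dist) auto
    moreover have "dist (x (K + T * Suc n)) (x K) \<le> (\<Sum>m\<le>n. A * sqrt (\<Phi> (K + T * m) - \<Phi> (K + T * m + T)))"
      by (rule Suc.IH) auto
    ultimately show ?case
      using dist_triangle[of "x j" "x K" "x (K + T * Suc n)"] by simp
  qed
  \<comment> \<open>The minimum matters for \<open>j = K + T * M + T\<close>, whose quotient is
    \<open>M + 1\<close>; this endpoint is counted in window \<open>M\<close>.\<close>
  moreover define n where "n = min M ((j - K) div T)"
  have "j \<in> {K + T * n..K + T * n + T}"
  proof (cases "(j - K) div T \<le> M")
    case True
    then have "n = (j - K) div T" by (simp add: n_def)
    then show ?thesis using j window_index[OF T_pos, of K j] by auto
  next
    case False
    then have "n = M" by (simp add: n_def)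
    moreover have "T * M \<le> j - K"
    proof -
      have "T * M \<le> T * ((j - K) div T)" using False by (intro mult_le_mono2) simp
      then show ?thesis using window_index(1)[OF T_pos, of K j] j unfolding atLeastAtMost_iff by linarith
    qed
    ultimately show ?thesis using j by auto
  qed
  ultimately have "dist (x j) (x K) \<le> A * (\<Sum>m\<le>n. sqrt (\<Phi> (K + T * m) - \<Phi> (K + T * m + T)))"
    by (simp add: sum_distrib_left)
  also have "\<dots> \<le> A * (2 * sqrt (\<Phi> K) + 2 * B * \<Phi> K powr (1 - \<theta>))"
  proof (intro mult_left_mono window_sum_bound)
    have "T * n \<le> T * M" by (simp add: n_def)
    then show "x j \<in> ball xbar \<rho>" if "j \<in> {K..K + T * n}" for j
      using that le_trans[of j "K + T * n" "K + T * M"] by (intro assms(2)) auto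
  qed (use A_pos assms in auto)
  finally show ?thesis by (simp add: G_def)
qed

lemma cluster_frequently:
  assumes "0 < e"
  shows "\<exists>k\<ge>n. dist (x k) xbar < e"
proof -
  obtain \<sigma> where \<sigma>: "strict_mono \<sigma>" "(x \<circ> \<sigma>) \<longlonglongrightarrow> xbar" using cluster by blast
  have "\<forall>\<^sub>F m in sequentially. dist ((x \<circ> \<sigma>) m) xbar < e"
    using \<sigma>(2) assms by (rule tendstoD)
  moreover have "\<forall>\<^sub>F m in sequentially. n \<le> \<sigma> m"
    using filterlim_subseq[OF \<sigma>(1)] by (simp add: filterlim_at_top)
  ultimately have "\<forall>\<^sub>F m in sequentially. dist ((x \<circ> \<sigma>) m) xbar < e \<and> n \<le> \<sigma> m"
    by eventually_elim simp
  then show ?thesis unfolding eventually_sequentially by auto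
qed

text \<open>Since \<open>G (\<Phi> k)\<close> tends to 0, some \<open>x K\<close> lies within
  \<open>\<rho> / 2\<close> of \<open>xbar\<close> while \<open>G (\<Phi> K) < \<rho> / 2\<close>.
  By induction on the number of windows, the iterates then never travel far enough to leave the
  ball.\<close>

lemma trapped:
  obtains K where "k0 \<le> K" "\<Phi> K \<le> 1" "\<And>j. j \<ge> K \<Longrightarrow> x j \<in> ball xbar \<rho>"
proof -
  have "(\<lambda>k. G (\<Phi> k)) \<longlonglongrightarrow> A * (2 * sqrt 0 + 2 * B * 0 powr (1 - \<theta>))"
    unfolding G_def using \<Phi>_null \<theta>_range
    by (intro tendsto_intros) (auto simp: eventually_sequentially intro!: exI[of _ k0] \<Phi>_nonneg)
  then have "(\<lambda>k. G (\<Phi> k)) \<longlonglongrightarrow> 0" using \<theta>_range by simp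
  then have "\<forall>\<^sub>F k in sequentially. G (\<Phi> k) < \<rho> / 2"
    using \<rho>_pos by (intro order_tendstoD) auto
  moreover have "\<forall>\<^sub>F k in sequentially. \<Phi> k < 1"
    using \<Phi>_null by (intro order_tendstoD) auto
  ultimately have "\<forall>\<^sub>F k in sequentially. G (\<Phi> k) < \<rho> / 2 \<and> \<Phi> k < 1"
    by eventually_elim simp
  then obtain N where N: "\<And>k. k \<ge> N \<Longrightarrow> G (\<Phi> k) < \<rho> / 2 \<and> \<Phi> k < 1"
    by (auto simp: eventually_sequentially)
  obtain K where K: "K \<ge> max N k0" "dist (x K) xbar < \<rho> / 2"
    using cluster_frequently[of "\<rho> / 2" "max N k0"] \<rho>_pos by auto
  have in_ball: "x j \<in> ball xbar \<rho>" if "dist (x j) (x K) \<le> G (\<Phi> K)" for j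
    using that K N[of K] dist_triangle[of "x j" xbar "x K"] by (simp add: dist_commute)
  have 0: "x j \<in> ball xbar \<rho>" if "j \<in> {K..K + T * M}" for j M
    using that
  proof (induction M arbitrary: j)
    case 0
    then show ?case using K \<rho>_pos by (simp add: dist_commute)
  next
    case (Suc M)
    have "dist (x j) (x K) \<le> G (\<Phi> K)"
      using K Suc by (intro travel_bound[of K M]) (auto simp: algebra_simps)
    then show ?case by (rule in_ball)
  qed
  have "x j \<in> ball xbar \<rho>" if "j \<ge> K" for j
    using that le_window_index[OF T_pos that] by (intro 0[of _ "j - K"]) auto
  then show ?thesis using that[of K] K N[of K] by simp
qed

text \<open>The recursion is the squared error bound. The distance is at most the remaining path
  length \<open>G (\<Phi> k)\<close>, where \<open>\<Phi> k \<le> 1\<close> and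
  \<open>\<theta> \<ge> 1 / 2\<close> let the power \<open>1 - \<theta>\<close> dominate the square
  root.\<close>

lemma rate_by_potential:
  obtains K C where "k0 \<le> K" "0 < C"
    "\<And>k. k \<ge> K \<Longrightarrow> \<Phi> (k + T) powr (2 * \<theta>) \<le> C * (\<Phi> k - \<Phi> (k + T))"
    "\<And>k. k \<ge> K \<Longrightarrow> dist (x k) xbar \<le> C * \<Phi> k powr (1 - \<theta>)"
proof -
  obtain K where K: "k0 \<le> K" "\<Phi> K \<le> 1" "\<And>j. j \<ge> K \<Longrightarrow> x j \<in> ball xbar \<rho>"
    using trapped by blast
  define C where "C = max (A\<^sup>2) (A * (2 + 2 * B))"
  have "\<Phi> (k + T) powr (2 * \<theta>) \<le> C * (\<Phi> k - \<Phi> (k + T))" if "k \<ge> K" for k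
  proof -
    have mono: "\<Phi> (k + T) \<le> \<Phi> k" using that K by (intro \<Phi>_antimono) auto
    have "\<Phi> (k + T) powr (2 * \<theta>) = (\<Phi> (k + T) powr \<theta>)\<^sup>2"
      by (simp add: power2_eq_square flip: powr_add)
    also have "\<dots> \<le> (A * sqrt (\<Phi> k - \<Phi> (k + T)))\<^sup>2"
      using that K by (intro power_mono window_error_bound) auto
    also have "\<dots> = A\<^sup>2 * (\<Phi> k - \<Phi> (k + T))" using mono by (simp add: power_mult_distrib)
    also have "\<dots> \<le> C * (\<Phi> k - \<Phi> (k + T))" using mono by (intro mult_right_mono) (auto simp: C_def)
    finally show ?thesis .
  qed
  moreover have "dist (x k) xbar \<le> C * \<Phi> k powr (1 - \<theta>)" if "k \<ge> K" for k
  proof -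
    have \<Phi>k: "0 \<le> \<Phi> k" "\<Phi> k \<le> 1" using that K \<Phi>_antimono[of K k] by (auto intro: \<Phi>_nonneg)
    have travel: "dist (x j) (x k) \<le> G (\<Phi> k)" if "j \<ge> k" for j
      using that \<open>k \<ge> K\<close> K T_pos
      le_window_index[OF T_pos that]
      by (intro travel_bound[of _ "j - k"]) auto
    \<comment> \<open>Some later iterate is within \<open>e\<close> of \<open>xbar\<close>, so the
      cluster point property suffices here.\<close>
    have "dist (x k) xbar \<le> G (\<Phi> k) + e" if "0 < e" for e
      using cluster_frequently[OF that, of k] travel dist_triangle[of "x k" xbar] 
      by (metis add_mono dist_commute less_imp_le order_trans)
    then have "dist (x k) xbar \<le> G (\<Phi> k)" by (rule field_le_epsilon)
    also have "\<dots> \<le> A * (2 * \<Phi> k powr (1 - \<theta>) + 2 * B * \<Phi> k powr (1 - \<theta>))"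
    proof -
      have "sqrt (\<Phi> k) = \<Phi> k powr (1 / 2)" using \<Phi>k by (simp add: powr_half_sqrt)
      also have "\<dots> \<le> \<Phi> k powr (1 - \<theta>)"
        using \<Phi>k \<theta>_range by (cases "\<Phi> k = 0") (auto intro!: powr_mono')
      finally show ?thesis using A_pos by (simp add: G_def)
    qed
    also have "\<dots> = A * (2 + 2 * B) * \<Phi> k powr (1 - \<theta>)" by (simp add: algebra_simps)
    also have "\<dots> \<le> C * \<Phi> k powr (1 - \<theta>)" by (intro mult_right_mono) (auto simp: C_def)
    finally show ?thesis .
  qed
  moreover have "0 < C" using A_pos by (auto simp: C_def less_max_iff_disj)
  ultimately show ?thesis using that K by blast
qed

text \<open>At \<open>\<theta> = 1 / 2\<close> the recursion is linear, and \<open>\<Phi>\<close>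
  shrinks by the factor \<open>C / (1 + C)\<close> in each window.\<close>

lemma linear_rate:
  assumes "\<theta> = 1 / 2"
  shows "\<exists>C>0. \<exists>a. 0 \<le> a \<and> a < 1 \<and> (\<forall>k\<ge>1. dist (x k) xbar \<le> C * a ^ k)"
proof -
  obtain K C where K: "k0 \<le> K" "0 < C"
    "\<And>k. k \<ge> K \<Longrightarrow> \<Phi> (k + T) powr (2 * \<theta>) \<le> C * (\<Phi> k - \<Phi> (k + T))"
    "\<And>k. k \<ge> K \<Longrightarrow> dist (x k) xbar \<le> C * \<Phi> k powr (1 - \<theta>)"
    using rate_by_potential by blast
  define g where "g = C / (1 + C)"
  have g: "0 < g" "g < 1" using K by (auto simp: g_def)
  \<comment> \<open>Rate per iteration for the distance: \<open>g\<close> acts on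
    \<open>\<Phi>\<close> over \<open>T\<close> iterations, and the distance is bounded by a
    multiple of \<open>sqrt (\<Phi> k)\<close>.\<close>
  define h where "h = g powr (1 / (2 * T))"
  have h: "0 < h" "h < 1"
    using g T_pos powr_less_mono2[of "1 / (2 * real T)" g 1] by (auto simp: h_def)
  have "\<Phi> (K + T * m) \<le> g ^ m * \<Phi> (K + T * 0)" for m
  proof (rule geometric_decay)
    fix m
    have "\<Phi> (K + T * m + T) \<le> C * (\<Phi> (K + T * m) - \<Phi> (K + T * m + T))"
      using K(3)[of "K + T * m"] \<Phi>_nonneg[of "K + T * m + T"] K(1) assms by simp
    then have "\<Phi> (K + T * m + T) \<le> g * \<Phi> (K + T * m)" using K by (simp add: g_def field_simps)
    then show "\<Phi> (K + T * Suc m) \<le> g * \<Phi> (K + T * m)" by (simp add: algebra_simps)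
  qed (use g in simp)
  then have decay: "\<Phi> (K + T * m) \<le> g ^ m * \<Phi> K" for m by simp
  have "dist (x k) xbar \<le> C * sqrt (\<Phi> K) * h powr (- real (K + T)) * h ^ k" if "k \<ge> K" for k
  proof -
    define m where "m = (k - K) div T"
    have mk: "K + T * m \<le> k" "k \<le> K + T * m + T"
      using window_index[OF T_pos that] by (auto simp: m_def)
    have "\<Phi> k \<le> \<Phi> (K + T * m)" using mk K by (intro \<Phi>_antimono) auto
    also have "\<dots> \<le> g ^ m * \<Phi> K" by (rule decay)
    finally have "sqrt (\<Phi> k) \<le> sqrt (g ^ m * \<Phi> K)" by simp
    also have "\<dots> = sqrt (\<Phi> K) * sqrt (g ^ m)" by (simp add: real_sqrt_mult)
    also have "sqrt (g ^ m) = h powr (T * m)"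
      using g T_pos by (simp add: h_def powr_powr powr_half_sqrt[symmetric] powr_realpow[symmetric])
    \<comment> \<open>Rounding to whole windows loses at most \<open>T\<close> iterations; with the
      offset \<open>K\<close> this loss goes into the constant.\<close>
    also have "\<dots> \<le> h powr (real k - real (K + T))"
      using h mk by (intro powr_mono') (auto simp flip: of_nat_add of_nat_mult)
    also have "\<dots> = h powr (- real (K + T)) * h ^ k"
      using h by (simp add: powr_realpow[symmetric] algebra_simps flip: powr_add)
    finally have "sqrt (\<Phi> k) \<le> sqrt (\<Phi> K) * (h powr (- real (K + T)) * h ^ k)"
      using \<Phi>_nonneg[of K] K by (simp add: mult_left_mono)
    then have "C * sqrt (\<Phi> k) \<le> C * (sqrt (\<Phi> K) * (h powr (- real (K + T)) * h ^ k))"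
      using K by (intro mult_left_mono) auto
    moreover have "dist (x k) xbar \<le> C * sqrt (\<Phi> k)"
      using K(4)[OF that] \<Phi>_nonneg[of k] that K(1) assms by (simp add: powr_half_sqrt)
    ultimately show ?thesis by (simp add: mult.assoc)
  qed
  then have "\<exists>C>0. \<forall>k\<ge>1. dist (x k) xbar \<le> C * h ^ k"
    using h by (intro bound_from_some_index_on) auto
  then show ?thesis using h by (meson less_imp_le)
qed

text \<open>Along windows the recursion is that of \<open>sublinear_decay\<close> with
  \<open>\<nu> = 2 * \<theta> - 1\<close>; taking the power \<open>1 - \<theta>\<close> of the
  resulting bound gives the claimed exponent.\<close>

lemma sublinear_rate:
  assumes "1 / 2 < \<theta>"
  shows "\<exists>C>0. \<forall>k\<ge>1. dist (x k) xbar \<le> C * real k powr (- ((1 - \<theta>) / (2 * \<theta> - 1)))"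
proof -
  obtain K C where K: "k0 \<le> K" "0 < C"
    "\<And>k. k \<ge> K \<Longrightarrow> \<Phi> (k + T) powr (2 * \<theta>) \<le> C * (\<Phi> k - \<Phi> (k + T))"
    "\<And>k. k \<ge> K \<Longrightarrow> dist (x k) xbar \<le> C * \<Phi> k powr (1 - \<theta>)"
    using rate_by_potential by blast
  define \<nu> where "\<nu> = 2 * \<theta> - 1"
  have \<nu>: "0 < \<nu>" "1 + \<nu> = 2 * \<theta>" using assms by (auto simp: \<nu>_def)
  obtain D where D: "0 < D" "\<And>m. \<Phi> (K + T * m) \<le> D * real (m + 1) powr (- (1 / \<nu>))"
  proof (rule sublinear_decay[of "\<lambda>m. \<Phi> (K + T * m)" \<nu> C])
    fix m
    show "\<Phi> (K + T * Suc m) powr (1 + \<nu>) \<le> C * (\<Phi> (K + T * m) - \<Phi> (K + T * Suc m))"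
      using K(3)[of "K + T * m"] \<nu> by (simp add: algebra_simps)
    show "0 \<le> \<Phi> (K + T * m)" using K by (intro \<Phi>_nonneg) auto
  qed (use \<nu> K in auto)
  have "dist (x k) xbar \<le> C * (D * (2 * T) powr (1 / \<nu>)) powr (1 - \<theta>) * real k powr (- ((1 - \<theta>) / \<nu>))"
    if k: "k \<ge> 2 * K + 1" for k
  proof -
    define m where "m = (k - K) div T"
    have mk: "K + T * m \<le> k" "k \<le> K + T * m + T"
      using window_index[OF T_pos, of K k] k by (auto simp: m_def)
    have "real k \<le> 2 * T * real (m + 1)"
    proof -
      define w where "w = T * m + T"
      have "k \<le> K + w" using mk(2) by (simp add: w_def)
      \<comment> \<open>The threshold \<open>2 * K + 1 \<le> k\<close> keeps the offset
        \<open>K\<close> below half of \<open>k\<close>, so the window count grows at least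
        proportionally to \<open>k\<close>.\<close>
      then have "k \<le> 2 * w" using k by linarith
      then have "k \<le> 2 * (T * m + T)" by (simp only: w_def)
      then show ?thesis
        by (metis distrib_left mult.assoc mult.right_neutral of_nat_le_iff of_nat_mult of_nat_numeral)
    qed
    then have "real k / (2 * T) \<le> real (m + 1)" using T_pos by (simp add: field_simps)
    then have "real (m + 1) powr (- (1 / \<nu>)) \<le> (real k / (2 * T)) powr (- (1 / \<nu>))"
      using \<nu> k T_pos by (intro powr_mono2') auto
    also have "\<dots> = (2 * T) powr (1 / \<nu>) * real k powr (- (1 / \<nu>))"
      using T_pos k by (simp add: powr_divide powr_minus field_simps)
    finally have le: "real (m + 1) powr (- (1 / \<nu>)) \<le> (2 * T) powr (1 / \<nu>) * real k powr (- (1 / \<nu>))" .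
    have "\<Phi> k \<le> \<Phi> (K + T * m)" using mk K by (intro \<Phi>_antimono) auto
    also have "\<dots> \<le> D * real (m + 1) powr (- (1 / \<nu>))" by (rule D)
    also have "\<dots> \<le> D * ((2 * T) powr (1 / \<nu>) * real k powr (- (1 / \<nu>)))"
      using D le by (intro mult_left_mono) auto
    finally have "\<Phi> k powr (1 - \<theta>) \<le> (D * ((2 * T) powr (1 / \<nu>) * real k powr (- (1 / \<nu>)))) powr (1 - \<theta>)"
      using \<theta>_range K k by (intro powr_mono2) (auto intro!: \<Phi>_nonneg)
    also have "\<dots> = (D * (2 * T) powr (1 / \<nu>)) powr (1 - \<theta>) * real k powr (- ((1 - \<theta>) / \<nu>))"
      using D by (simp add: powr_mult powr_powr)
    finally have "C * \<Phi> k powr (1 - \<theta>)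
        \<le> C * ((D * (2 * T) powr (1 / \<nu>)) powr (1 - \<theta>) * real k powr (- ((1 - \<theta>) / \<nu>)))"
      using K by (intro mult_left_mono) auto
    then show ?thesis using K(4)[of k] k by (simp add: mult.assoc)
  qed
  then have "\<exists>C>0. \<forall>k\<ge>1. dist (x k) xbar \<le> C * real k powr (- ((1 - \<theta>) / \<nu>))"
    by (intro bound_from_some_index_on) auto
  then show ?thesis by (simp add: \<nu>_def)
qed

end

section \<open>Block coordinates and subgradients\<close>

lemma block_proj_simps:
  "block_proj p i (u + v) = block_proj p i u + block_proj p i v"
  "block_proj p i (u - v) = block_proj p i u - block_proj p i v"
  "block_proj p i (c *\<^sub>R u) = c *\<^sub>R block_proj p i u"
  by (auto simp: block_proj_def vec_eq_iff)

lemma block_proj_mem [simp]: "block_proj p i u \<in> block_space p i"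
  by (simp add: block_proj_def block_space_def)

lemma block_proj_ident: "u \<in> block_space p i \<Longrightarrow> block_proj p i u = u"
  by (auto simp: block_proj_def block_space_def vec_eq_iff)

lemma block_proj_idem [simp]: "block_proj p i (block_proj p i u) = block_proj p i u"
  by (simp add: block_proj_ident)

lemma block_space_closed:
  "u \<in> block_space p i \<Longrightarrow> v \<in> block_space p i \<Longrightarrow> u + v \<in> block_space p i"
  "u \<in> block_space p i \<Longrightarrow> v \<in> block_space p i \<Longrightarrow> u - v \<in> block_space p i"
  "u \<in> block_space p i \<Longrightarrow> c *\<^sub>R u \<in> block_space p i"
  by (auto simp: block_space_def)

lemma sum_block_proj: "(\<Sum>i\<in>UNIV. block_proj p i u) = u"
  for p :: "'n::finite \<Rightarrow> 's::finite"
  by (simp add: block_proj_def vec_eq_iff)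

lemma inner_block_proj: "v \<in> block_space p i \<Longrightarrow> v \<bullet> block_proj p i u = v \<bullet> u"
  unfolding inner_vec_def by (intro sum.cong) (auto simp: block_proj_def block_space_def)

lemma norm_block_proj_le: "norm (block_proj p i u) \<le> norm u"
  by (intro norm_le_componentwise_cart) (auto simp: block_proj_def)

lemma bounded_linear_block_proj: "bounded_linear (block_proj p i)"
  by (intro bounded_linear_intro[where K = 1]) (simp_all add: block_proj_simps norm_block_proj_le)

lemmas tendsto_block_proj = bounded_linear.tendsto[OF bounded_linear_block_proj]

lemma block_subst_eq:
  "block_subst p i x u = x + (block_proj p i u - block_proj p i x)"
  by (auto simp: block_subst_def block_proj_def vec_eq_iff)

section \<open>Smooth descent, subgradients and the KL inequality\<close>

text \<open>The descent lemma along a single segment. Only the gradient increment in direction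
  \<open>d\<close> enters, so a block Lipschitz constant can be used; \<open>M\<close> stands for
  that constant times the squared length of \<open>d\<close>.\<close>

lemma smooth_upper_bound:
  fixes f :: "'a::real_inner \<Rightarrow> real"
  assumes grad: "\<And>z. GDERIV f z :> g z"
    and lip: "\<And>t. 0 \<le> t \<Longrightarrow> t \<le> 1 \<Longrightarrow> (g (z + t *\<^sub>R d) - g z) \<bullet> d \<le> t * M"
  shows "f (z + d) - f z \<le> g z \<bullet> d + M / 2"
proof -
  define h where "h t = f (z + t *\<^sub>R d) - t * (g z \<bullet> d) - M / 2 * t\<^sup>2" for t
  have "h 1 \<le> h 0"
  proof (rule DERIV_nonpos_imp_nonincreasing[of 0 1 h])
    fix t :: real assume t: "0 \<le> t" "t \<le> 1"
    have "((\<lambda>t. z + t *\<^sub>R d) has_derivative (\<lambda>s. s *\<^sub>R d)) (at t)"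
      by (auto intro!: derivative_eq_intros)
    from has_derivative_compose[OF this grad[unfolded gderiv_def]] have "((\<lambda>t. f (z + t *\<^sub>R d)) has_real_derivative (g (z + t *\<^sub>R d) \<bullet> d)) (at t)"
      unfolding has_field_derivative_def
      by (rule has_derivative_eq_rhs) (simp add: fun_eq_iff inner_commute mult.commute)
    then have "(h has_real_derivative (g (z + t *\<^sub>R d) \<bullet> d - g z \<bullet> d - M * t)) (at t)"
      unfolding h_def by (auto intro!: derivative_eq_intros)
    moreover have "g (z + t *\<^sub>R d) \<bullet> d - g z \<bullet> d - M * t \<le> 0"
      using lip[OF t] by (simp add: inner_diff_left mult.commute)
    ultimately show "\<exists>y. (h has_real_derivative y) (at t) \<and> y \<le> 0" by blast
  qed simp
  then show ?thesis by (simp add: h_def)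
qed

lemma GDERIV_remainder:
  fixes x :: "'a::euclidean_space"
  assumes "GDERIV f x :> g" "0 < e"
  shows "\<forall>\<^sub>F y in at x. norm (f y - f x - (y - x) \<bullet> g) / norm (y - x) < e"
proof -
  have "(\<lambda>y. (f y - f x - (y - x) \<bullet> g) /\<^sub>R norm (y - x)) \<midarrow>x\<rightarrow> 0"
    using assms unfolding gderiv_def has_derivative_def by (simp add: Lim_ident_at)
  then have "\<forall>\<^sub>F y in at x. dist ((f y - f x - (y - x) \<bullet> g) /\<^sub>R norm (y - x)) 0 < e"
    using assms by (intro tendstoD)
  moreover have "dist ((f y - f x - (y - x) \<bullet> g) /\<^sub>R norm (y - x)) 0
      = norm (f y - f x - (y - x) \<bullet> g) / norm (y - x)" for y
    unfolding dist_norm diff_0_right norm_scaleR abs_inverse abs_norm_cancel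
    by (rule divide_inverse_commute[symmetric])
  ultimately show ?thesis by (simp only:)
qed

text \<open>Each \<open>r i\<close> has a quadratic minorant with slope \<open>- v i\<close> that
  touches it at the block of \<open>x\<close>. The nonsmooth part is separable, so the minorants add
  up whatever their origin, and their quadratic error vanishes in the Frechet quotient.\<close>

lemma objective_frechet_subgradient:
  fixes p :: "'n::finite \<Rightarrow> 's::finite"
  assumes grad: "GDERIV f x :> g"
    and v: "\<And>i. v i \<in> block_space p i"
    and rx: "\<And>i. r i (block_proj p i x) = ereal (R i)"
    and model: "\<And>i u. u \<in> block_space p i \<Longrightarrow>
      ereal (R i - v i \<bullet> (u - block_proj p i x) - M * (norm (u - block_proj p i x))\<^sup>2) \<le> r i u"
    and M: "0 \<le> M"
  shows "g - (\<Sum>i\<in>UNIV. v i) \<in> frechet_subdiff (objective p f r) x"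
proof -
  let ?F = "objective p f r" and ?g = "g - (\<Sum>i\<in>UNIV. v i)"
  \<comment> \<open>Each block distance is bounded by the full distance, hence the number of
    blocks.\<close>
  define N where "N = M * real CARD('s)"
  have Fx: "?F x = ereal (f x + (\<Sum>i\<in>UNIV. R i))"
    by (simp add: objective_def rx)
  have lower: "ereal (f y + (\<Sum>i\<in>UNIV. R i) - (\<Sum>i\<in>UNIV. v i) \<bullet> (y - x) - N * (norm (y - x))\<^sup>2) \<le> ?F y" for y
  proof -
    have "R i - v i \<bullet> (y - x) - M * (norm (y - x))\<^sup>2
        \<le> R i - v i \<bullet> (block_proj p i y - block_proj p i x)
          - M * (norm (block_proj p i y - block_proj p i x))\<^sup>2" for i
    proof -
      have "v i \<bullet> (block_proj p i y - block_proj p i x) = v i \<bullet> (y - x)"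
        using inner_block_proj[OF v, of i "y - x"] by (simp add: block_proj_simps)
      moreover have "(norm (block_proj p i y - block_proj p i x))\<^sup>2 \<le> (norm (y - x))\<^sup>2"
        using norm_block_proj_le[of p i "y - x"] by (intro power_mono) (auto simp: block_proj_simps)
      ultimately show ?thesis using M by (simp add: mult_left_mono)
    qed
    then have "ereal (R i - v i \<bullet> (y - x) - M * (norm (y - x))\<^sup>2) \<le> r i (block_proj p i y)" for i
      using model[of "block_proj p i y" i] by (meson block_proj_mem ereal_less_eq(3) order_trans)
    then have "(\<Sum>i\<in>UNIV. ereal (R i - v i \<bullet> (y - x) - M * (norm (y - x))\<^sup>2)) \<le> (\<Sum>i\<in>UNIV. r i (block_proj p i y))"
      by (intro sum_mono)
    then have "ereal (f y) + (\<Sum>i\<in>UNIV. ereal (R i - v i \<bullet> (y - x) - M * (norm (y - x))\<^sup>2)) \<le> ?F y"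
      unfolding objective_def by (intro add_left_mono)
    moreover have "f y + (\<Sum>i\<in>UNIV. R i - v i \<bullet> (y - x) - M * (norm (y - x))\<^sup>2)
        = f y + (\<Sum>i\<in>UNIV. R i) - (\<Sum>i\<in>UNIV. v i) \<bullet> (y - x) - N * (norm (y - x))\<^sup>2"
      by (simp add: sum_subtractf inner_sum_left N_def)
    ultimately show ?thesis by simp
  qed
  have "0 \<le> Liminf (at x) (\<lambda>y. (?F y - ?F x - ereal (?g \<bullet> (y - x))) / ereal (norm (y - x)))"
    unfolding le_Liminf_iff
  proof (intro allI impI)
    fix c :: ereal assume "c < 0"
    then have "\<exists>e>0. c \<le> ereal (- e)"
    proof (cases c)
      case (real r)
      then show ?thesis using \<open>c < 0\<close> by (intro exI[of _ "- r"]) simp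
    next
      case MInf
      then show ?thesis by (intro exI[of _ 1]) simp
    qed simp
    then obtain e where e: "0 < e" "c \<le> ereal (- e)" by blast
    have "\<forall>\<^sub>F y in at x. norm (f y - f x - (y - x) \<bullet> g) / norm (y - x) < e / 2"
      using grad e(1) by (intro GDERIV_remainder) auto
    \<comment> \<open>Half of \<open>e\<close> pays for the remainder of \<open>f\<close>, the other
      half for the quadratic term; \<open>N\<close> may be 0, hence \<open>N + 1\<close>.\<close>
    moreover have "\<forall>\<^sub>F y in at x. dist y x < e / (2 * (N + 1))"
    proof (rule tendstoD[OF tendsto_ident_at])
      show "0 < e / (2 * (N + 1))" using e M by (simp add: N_def add_nonneg_pos)
    qed
    moreover have "\<forall>\<^sub>F y in at x. y \<noteq> x" by (simp add: eventually_at_filter)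
    ultimately show "\<forall>\<^sub>F y in at x. c < (?F y - ?F x - ereal (?g \<bullet> (y - x))) / ereal (norm (y - x))"
    proof eventually_elim
      case (elim y)
      define s where "s = norm (y - x)"
      have N: "0 \<le> N" using M by (simp add: N_def)
      have s: "0 < s" "s < e / (2 * (N + 1))" using elim by (auto simp: s_def dist_norm)
      have "\<bar>f y - f x - (y - x) \<bullet> g\<bar> < e / 2 * s"
        using elim(1) s(1) by (simp only: s_def real_norm_def pos_divide_less_eq)
      then have 1: "f x + g \<bullet> (y - x) - e / 2 * s < f y"
        unfolding inner_commute[of g] by linarith
      have "N * s \<le> (N + 1) * s" using s by simp
      also have "\<dots> < e / 2" using s N by (simp add: field_simps)
      finally have "N * s * s < e / 2 * s" using s by (intro mult_strict_right_mono)
      then have 2: "N * s\<^sup>2 < e / 2 * s" by (simp add: power2_eq_square mult.assoc)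
      have "f x + (\<Sum>i\<in>UNIV. R i) + ?g \<bullet> (y - x) - e * s
          < f y + (\<Sum>i\<in>UNIV. R i) - (\<Sum>i\<in>UNIV. v i) \<bullet> (y - x) - N * s\<^sup>2"
        using 1 2 unfolding inner_diff_left by linarith
      then have "ereal (f x + (\<Sum>i\<in>UNIV. R i) + ?g \<bullet> (y - x) - e * s)
          < ereal (f y + (\<Sum>i\<in>UNIV. R i) - (\<Sum>i\<in>UNIV. v i) \<bullet> (y - x) - N * s\<^sup>2)"
        by (simp only: less_ereal.simps)
      also have "\<dots> \<le> ?F y" unfolding s_def by (rule lower)
      finally have less: "ereal (f x + (\<Sum>i\<in>UNIV. R i) + ?g \<bullet> (y - x) - e * s) < ?F y" .
      have "ereal (- e) < (?F y - ?F x - ereal (?g \<bullet> (y - x))) / ereal s"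
      proof (cases "?F y")
        case (real r)
        then have "- e * s < r - (f x + (\<Sum>i\<in>UNIV. R i)) - ?g \<bullet> (y - x)"
          using less unfolding real less_ereal.simps by linarith
        then have "- e < (r - (f x + (\<Sum>i\<in>UNIV. R i)) - ?g \<bullet> (y - x)) / s"
          using s by (simp only: pos_less_divide_eq)
        then show ?thesis by (simp only: real Fx ereal_minus ereal_divide less_ereal.simps s(1)[THEN less_imp_neq, symmetric] if_False)
      next
        case PInf
        then show ?thesis using s by (simp add: Fx)
      next
        case MInf
        then show ?thesis using less by simp
      qed
      then show ?case using e(2) by (simp add: s_def)
    qed
  qed
  moreover have "x \<in> eff_dom ?F" using Fx by (simp add: eff_dom_def)
  ultimately show ?thesis unfolding frechet_subdiff_def mem_Collect_eq by blast
qed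

lemma frechet_subset_limiting: "frechet_subdiff \<psi> x \<subseteq> limiting_subdiff \<psi> x"
proof
  fix g assume "g \<in> frechet_subdiff \<psi> x"
  then have "(\<lambda>_::nat. x) \<longlonglongrightarrow> x \<and> (\<forall>m::nat. g \<in> frechet_subdiff \<psi> x) \<and> (\<lambda>_::nat. g) \<longlonglongrightarrow> g"
    by simp
  then show "g \<in> limiting_subdiff \<psi> x"
    unfolding limiting_subdiff_def mem_Collect_eq by fast
qed

text \<open>\<open>Liminf\<close> ignores the point \<open>u\<close> itself; terms of
  \<open>X\<close> equal to \<open>u\<close> are covered by \<open>y < g u\<close>.\<close>

lemma lsc_on_sequence:
  assumes "lsc_on S g" "u \<in> S" "X \<longlonglongrightarrow> u" "\<And>n. X n \<in> S" "y < g u"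
  shows "\<forall>\<^sub>F n in sequentially. y < g (X n)"
proof -
  have "y < Liminf (at u within S) g"
    using assms unfolding lsc_on_def by (meson less_le_trans)
  then have "\<forall>\<^sub>F z in at u within S. y < g z"
    by (metis dense le_Liminf_iff order.strict_implies_order)
  then have "\<forall>\<^sub>F z in nhds u. z \<noteq> u \<longrightarrow> z \<in> S \<longrightarrow> y < g z"
    by (simp add: eventually_at_filter)
  then have "\<forall>\<^sub>F n in sequentially. X n \<noteq> u \<longrightarrow> X n \<in> S \<longrightarrow> y < g (X n)"
    using assms(3) by (rule eventually_compose_filterlim)
  then show ?thesis by eventually_elim (use assms in metis)
qed

text \<open>The derivative of \<open>c * a powr (1 - \<theta>)\<close> at \<open>t\<close> is
  \<open>c * (1 - \<theta>) * t powr (- \<theta>)\<close>, and the norm of any limiting subgradient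
  bounds the distance to 0 from above.\<close>

lemma KL_property_powr_bound:
  assumes "KL_property \<psi> xbar \<rho> \<eta> \<theta>"
  obtains c where "0 < c"
    "\<And>x g t s. x \<in> ball xbar \<rho> \<Longrightarrow> g \<in> limiting_subdiff \<psi> x \<Longrightarrow> \<psi> xbar = ereal s \<Longrightarrow>
       \<psi> x = ereal (s + t) \<Longrightarrow> 0 < t \<Longrightarrow> t < \<eta> \<Longrightarrow> t powr \<theta> \<le> c * norm g"
proof -
  obtain c where c: "0 < c" "\<theta> < 1" and kl: "\<And>x. x \<in> ball xbar \<rho> \<inter> dom_subdiff \<psi> \<Longrightarrow>
     \<psi> xbar < \<psi> x \<and> \<psi> x < \<psi> xbar + ereal \<eta> \<Longrightarrow>
     1 \<le> deriv (\<lambda>a. c * a powr (1 - \<theta>)) \<bar>real_of_ereal (\<psi> x - \<psi> xbar)\<bar> * infdist 0 (limiting_subdiff \<psi> x)"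
    using assms unfolding KL_property_def by blast
  show ?thesis
  proof (rule that[of "c * (1 - \<theta>)"])
    show "0 < c * (1 - \<theta>)" using c by simp
    fix x g t s
    assume *: "x \<in> ball xbar \<rho>" "g \<in> limiting_subdiff \<psi> x" "\<psi> xbar = ereal s"
      "\<psi> x = ereal (s + t)" "0 < t" "t < \<eta>"
    have "((\<lambda>a. c * a powr (1 - \<theta>)) has_real_derivative c * ((1 - \<theta>) * t powr (1 - \<theta> - 1))) (at t)"
      using * by (intro DERIV_cmult has_real_derivative_powr)
    then have "deriv (\<lambda>a. c * a powr (1 - \<theta>)) t = c * (1 - \<theta>) * t powr (- \<theta>)"
      by (simp add: DERIV_imp_deriv)
    moreover have "1 \<le> deriv (\<lambda>a. c * a powr (1 - \<theta>)) t * infdist 0 (limiting_subdiff \<psi> x)"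
      using kl[of x] * by (auto simp: dom_subdiff_def)
    moreover have "infdist 0 (limiting_subdiff \<psi> x) \<le> norm g"
      using infdist_le[OF *(2), of 0] by simp
    ultimately have "1 \<le> c * (1 - \<theta>) * t powr (- \<theta>) * norm g"
      using c by (smt (verit) mult_left_mono mult_nonneg_nonneg powr_ge_zero)
    then show "t powr \<theta> \<le> c * (1 - \<theta>) * norm g"
      using * by (simp add: powr_minus field_simps)
  qed
qed

lemma powr_add_le:
  fixes a b t :: real
  assumes "0 \<le> a" "0 \<le> b" "0 \<le> t" "t \<le> 1"
  shows "(a + b) powr t \<le> 2 * (a powr t + b powr t)"
proof -
  have "(a + b) powr t \<le> (2 * max a b) powr t"
    using assms by (intro powr_mono2) auto
  also have "\<dots> = 2 powr t * max a b powr t" using assms by (simp add: powr_mult)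
  also have "\<dots> \<le> 2 * (a powr t + b powr t)"
  proof (intro mult_mono)
    show "2 powr t \<le> (2::real)" using powr_mono[of t 1 2] assms by simp
    show "max a b powr t \<le> a powr t + b powr t" by (simp add: max_def)
  qed auto
  finally show ?thesis .
qed

lemma sum_diff_single:
  fixes g h :: "'a::finite \<Rightarrow> 'b::ab_group_add"
  assumes "\<And>j. j \<noteq> i \<Longrightarrow> h j = g j"
  shows "sum h UNIV - sum g UNIV = h i - g i"
proof -
  have "sum h (UNIV - {i}) = sum g (UNIV - {i})" using assms by (intro sum.cong) auto
  then show ?thesis by (simp add: sum.remove[of UNIV i])
qed

section \<open>The block prox-linear iteration\<close>

lemma squeeze_zero:
  fixes g h :: "nat \<Rightarrow> real"
  assumes "h \<longlonglongrightarrow> 0" "\<And>n. 0 \<le> g n" "\<And>n. g n \<le> h n"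
  shows "g \<longlonglongrightarrow> 0"
  using assms by (intro tendsto_sandwich[of "\<lambda>_. 0" g sequentially h]) auto

locale bpl =
  fixes p :: "'n::finite \<Rightarrow> 's::finite"
    and f :: "real ^ 'n \<Rightarrow> real"
    and gradf :: "real ^ 'n \<Rightarrow> real ^ 'n"
    and r :: "'s \<Rightarrow> real ^ 'n \<Rightarrow> ereal"
    and x :: "nat \<Rightarrow> real ^ 'n"
    and b :: "nat \<Rightarrow> 's"
    and \<omega> \<alpha> L :: "nat \<Rightarrow> real"
    and L0 :: "'s \<Rightarrow> real"
    and Lmin Lmax \<delta> :: real
    and T :: nat
  assumes f_grad: "\<And>z. GDERIV f z :> gradf z"
    and f_C1: "continuous_on UNIV gradf"
    and r_proper: "\<And>i. proper_on (block_space p i) (r i)"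
    and r_lsc: "\<And>i. lsc_on (block_space p i) (r i)"
    and F_bounded_below: "\<exists>m::real. \<forall>z\<in>eff_dom (objective p f r). ereal m \<le> objective p f r z"
    and bpl: "BPL_sequence p gradf r b \<omega> \<alpha> x"
    and \<omega>_range: "\<And>k. k \<ge> 1 \<Longrightarrow> 0 \<le> \<omega> k \<and> \<omega> k \<le> 1"
    and block_lipschitz: "\<And>k. k \<ge> 1 \<Longrightarrow>
          (L k)-lipschitz_on (block_space p (b k))
            (\<lambda>u. block_proj p (b k) (gradf (block_subst p (b k) (x (k - 1)) u)))"
    and L_bounds: "0 < Lmin" "\<And>k. k \<ge> 1 \<Longrightarrow> Lmin \<le> L k \<and> L k \<le> Lmax"
    and essentially_cyclic: "\<And>k i. k \<ge> 1 \<Longrightarrow> \<exists>m\<in>{k..<k + T}. b m = i"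
    and \<alpha>_choice: "\<And>k. k \<ge> 1 \<Longrightarrow> \<alpha> k = 1 / (2 * L k)"
    and L0_pos: "\<And>i. L0 i > 0"
    and \<delta>_range: "0 \<le> \<delta>" "\<delta> < 1"
    and \<omega>_choice: "\<And>i j. j \<ge> 1 \<Longrightarrow>
          \<omega> (update_iter b i j)
            \<le> \<delta> / 6 * sqrt (at_update b L L0 i (j - 1) / at_update b L L0 i j)"
begin

lemma L_pos: "0 < L (Suc k)" "Lmin \<le> L (Suc k)" "L (Suc k) \<le> Lmax"
  using L_bounds(1) L_bounds(2)[of "Suc k"] by auto

lemma Lmax_pos: "0 < Lmax"
  using L_pos[of 0] by linarith

lemma T_pos: "0 < T"
  using essentially_cyclic[of 1 undefined] by (cases T) auto

subsection \<open>Latest steps and their Lipschitz constants\<close>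

text \<open>\<open>prev_iterate\<close> looks strictly before its index, so \<open>Suc k\<close>
  takes an update at iteration \<open>k\<close> into account. For a block not yet updated the step
  is 0.\<close>

definition last_step :: "nat \<Rightarrow> 's \<Rightarrow> real ^ 'n" where
  "last_step k i = block_proj p i (x k) - block_proj p i (prev_iterate b x (Suc k) i)"

text \<open>The per-block constants indexed by iterations: the value at the latest update of block
  \<open>i\<close>, with \<open>L0 i\<close> before the first one.\<close>

primrec last_L :: "nat \<Rightarrow> 's \<Rightarrow> real" where
  "last_L 0 i = L0 i"
| "last_L (Suc k) i = (if b (Suc k) = i then L (Suc k) else last_L k i)"

lemma x_keep: "i \<noteq> b (Suc k) \<Longrightarrow> block_proj p i (x (Suc k)) = block_proj p i (x k)"
  using bpl unfolding BPL_sequence_def by (metis One_nat_def Suc_le_mono diff_Suc_1 le0)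

lemma step_in_block: "block_proj p (b (Suc k)) (x (Suc k) - x k) = x (Suc k) - x k"
proof -
  have "x (Suc k) - x k = (\<Sum>i\<in>UNIV. block_proj p i (x (Suc k) - x k))"
    by (rule sum_block_proj[symmetric])
  also have "\<dots> = (\<Sum>i\<in>{b (Suc k)}. block_proj p i (x (Suc k) - x k))"
    by (intro sum.mono_neutral_right) (auto simp: block_proj_simps x_keep)
  finally show ?thesis by simp
qed

lemma last_step_update: "last_step (Suc k) (b (Suc k)) = x (Suc k) - x k"
proof -
  let ?M = "{m. 1 \<le> m \<and> m < Suc (Suc k) \<and> b m = b (Suc k)}"
  have "finite ?M" by (rule finite_subset[of _ "{..Suc k}"]) auto
  then have "Max ?M = Suc k" by (intro Max_eqI) auto
  moreover have "Suc k \<in> ?M" by simp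
  ultimately have "prev_iterate b x (Suc (Suc k)) (b (Suc k)) = x k"
    unfolding prev_iterate_def Let_def by (metis (no_types, lifting) diff_Suc_1 empty_iff)
  then show ?thesis
    using step_in_block[of k] by (simp add: last_step_def block_proj_simps)
qed

lemma last_step_keep:
  assumes "i \<noteq> b (Suc k)"
  shows "last_step (Suc k) i = last_step k i"
proof -
  have "{m. 1 \<le> m \<and> m < Suc (Suc k) \<and> b m = i} = {m. 1 \<le> m \<and> m < Suc k \<and> b m = i}"
    using assms by (auto simp: less_Suc_eq)
  then have "prev_iterate b x (Suc (Suc k)) i = prev_iterate b x (Suc k) i"
    unfolding prev_iterate_def by simp
  then show ?thesis using assms by (simp add: last_step_def x_keep)
qed

lemma last_step_mem: "last_step k i \<in> block_space p i"
  unfolding last_step_def by (intro block_space_closed) auto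

lemma last_L_pos: "0 < last_L k i"
  by (induction k) (use L0_pos L_pos in auto)

lemma last_L_const:
  assumes "l \<le> k" "\<And>m. l < m \<Longrightarrow> m \<le> k \<Longrightarrow> b m \<noteq> i"
  shows "last_L k i = last_L l i"
  using assms by (induction k rule: dec_induct) auto

text \<open>The parameter choice compares consecutive updates of one block; locating iteration
  \<open>Suc k\<close> in the enumeration of these updates identifies the preceding constant as
  \<open>last_L k\<close>.\<close>

lemma \<omega>_le: "\<omega> (Suc k) \<le> \<delta> / 6 * sqrt (last_L k (b (Suc k)) / L (Suc k))"
proof -
  define i where "i = b (Suc k)"
  define S where "S = {m. 1 \<le> m \<and> b m = i}"
  have "\<exists>m>n. m \<in> S" for n
  proof -
    obtain m where "m \<in> {Suc n..<Suc n + T}" "b m = i" using essentially_cyclic[of "Suc n" i] by auto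
    then show ?thesis by (intro exI[of _ m]) (auto simp: S_def)
  qed
  then have inf: "infinite S" by (auto simp: infinite_nat_iff_unbounded)
  have "Suc k \<in> S" by (simp add: S_def i_def)
  \<comment> \<open>\<open>enumerate\<close> counts from 0, so this is update number
    \<open>Suc n\<close> of the block, and \<open>n = 0\<close> leads to the initial value
    \<open>L0 i\<close>.\<close>
  then obtain n where n: "enumerate S n = Suc k" using enumerate_Ex[OF inf] by metis
  have "at_update b L L0 i n = last_L k i"
  proof (cases n)
    case 0
    then have "Suc k = (LEAST m. m \<in> S)" using n by (simp add: enumerate_0)
    then have "m \<notin> S" if "m < Suc k" for m using not_less_Least that by metis
    then have "last_L k i = last_L 0 i" by (intro last_L_const) (auto simp: S_def)
    then show ?thesis using 0 by (simp add: at_update_def)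
  next
    case (Suc n')
    define l where "l = enumerate S n'"
    have l: "l \<in> S" using enumerate_in_set[OF inf] by (simp add: l_def)
    have "Suc k = (LEAST m. m \<in> S \<and> l < m)"
      using n Suc enumerate_Suc''[OF inf] by (simp add: l_def)
    then have between: "\<not> (m \<in> S \<and> l < m)" if "m < Suc k" for m using not_less_Least that by metis
    have "b m \<noteq> i" if "l < m" "m \<le> k" for m using between[of m] that by (auto simp: S_def)
    moreover have "l < Suc k" using n Suc enumerate_step[OF inf, of n'] by (simp add: l_def)
    ultimately have "last_L k i = last_L l i" by (intro last_L_const) auto
    also have "\<dots> = L l" using l by (cases l) (auto simp: S_def)
    finally show ?thesis using Suc by (simp add: at_update_def update_iter_def l_def S_def)
  qed
  then show ?thesis
    using \<omega>_choice[of "Suc n" i] n by (simp add: at_update_def update_iter_def S_def i_def)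
qed

lemma \<omega>_sq_le: "L (Suc k) * (\<omega> (Suc k))\<^sup>2 \<le> \<delta>\<^sup>2 / 36 * last_L k (b (Suc k))"
proof -
  have "(\<omega> (Suc k))\<^sup>2 \<le> (\<delta> / 6 * sqrt (last_L k (b (Suc k)) / L (Suc k)))\<^sup>2"
    using \<omega>_range[of "Suc k"] \<omega>_le by (intro power_mono) auto
  also have "\<dots> = \<delta>\<^sup>2 / 36 * (last_L k (b (Suc k)) / L (Suc k))"
    using last_L_pos[of k "b (Suc k)"] L_pos[of k] by (simp add: power_mult_distrib power_divide)
  finally show ?thesis using L_pos[of k] by (simp add: field_simps)
qed

text \<open>The second summand bounds the displacement caused by extrapolation in iteration
  \<open>k\<close>.\<close>

definition q :: "nat \<Rightarrow> real" where
  "q k = norm (x k - x (k - 1)) + norm (last_step (k - 1) (b k))"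

lemma q_nonneg: "0 \<le> q k"
  by (simp add: q_def)

subsection \<open>The proximal step\<close>

text \<open>\<open>hat k\<close> is the extrapolated point of iteration \<open>k + 1\<close>.\<close>

definition hat :: "nat \<Rightarrow> real ^ 'n" where
  "hat k = block_proj p (b (Suc k)) (x k) + \<omega> (Suc k) *\<^sub>R last_step k (b (Suc k))"

definition hat_point :: "nat \<Rightarrow> real ^ 'n" where
  "hat_point k = block_subst p (b (Suc k)) (x k) (hat k)"

definition hat_grad :: "nat \<Rightarrow> real ^ 'n" where
  "hat_grad k = block_proj p (b (Suc k)) (gradf (hat_point k))"

lemma hat_mem: "hat k \<in> block_space p (b (Suc k))"
  unfolding hat_def by (intro block_space_closed last_step_mem) auto

lemma hat_point_eq: "hat_point k = x k + \<omega> (Suc k) *\<^sub>R last_step k (b (Suc k))"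
  unfolding hat_point_def block_subst_eq using block_proj_ident[OF hat_mem, of k] by (simp add: hat_def)

lemma norm_\<omega>_last_step_le: "norm (\<omega> (Suc k) *\<^sub>R last_step k (b (Suc k))) \<le> norm (last_step k (b (Suc k)))"
  using \<omega>_range[of "Suc k"] by (simp add: mult_left_le_one_le)

lemma prox_step:
  assumes "u \<in> block_space p (b (Suc k))"
  defines "z \<equiv> block_proj p (b (Suc k)) (x (Suc k))"
  shows "ereal (hat_grad k \<bullet> (z - hat k) + L (Suc k) * (norm (z - hat k))\<^sup>2) + r (b (Suc k)) z
    \<le> ereal (hat_grad k \<bullet> (u - hat k) + L (Suc k) * (norm (u - hat k))\<^sup>2) + r (b (Suc k)) u"
proof -
  have hat: "extrapolated p b \<omega> x (Suc k) = hat k"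
    by (simp add: extrapolated_def hat_def last_step_def)
  have "1 / (2 * \<alpha> (Suc k)) = L (Suc k)" using \<alpha>_choice[of "Suc k"] L_pos[of k] by simp
  moreover have "is_arg_min
          (\<lambda>u. ereal (block_proj p (b (Suc k)) (gradf (block_subst p (b (Suc k)) (x k) (hat k))) \<bullet> (u - hat k)
                      + 1 / (2 * \<alpha> (Suc k)) * (norm (u - hat k))\<^sup>2) + r (b (Suc k)) u)
          (\<lambda>u. u \<in> block_space p (b (Suc k)))
          (block_proj p (b (Suc k)) (x (Suc k)))"
  proof -
    have "1 \<le> Suc k" by simp
    from bpl[unfolded BPL_sequence_def Let_def, THEN spec, THEN mp, OF this, THEN conjunct2]
    show ?thesis by (simp only: hat diff_Suc_1)
  qed
  ultimately show ?thesis
    using assms(1) unfolding is_arg_min_def z_def hat_grad_def hat_point_def by (auto simp: not_less)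
qed

definition R :: "nat \<Rightarrow> 's \<Rightarrow> real" where
  "R k i = real_of_ereal (r i (block_proj p i (x k)))"

lemma r_not_MInf: "u \<in> block_space p i \<Longrightarrow> r i u \<noteq> - \<infinity>"
  using r_proper[of i] by (simp add: proper_on_def)

text \<open>At the starting point \<open>r i\<close> may be infinite. The proximal minimizer has a
  finite value because \<open>r i\<close> is proper, and that value persists until the next
  update.\<close>

lemma r_updated:
  assumes "1 \<le> j" "j \<le> k" "b j = i"
  shows "r i (block_proj p i (x k)) = ereal (R k i)"
proof -
  have upd: "r (b (Suc k)) (block_proj p (b (Suc k)) (x (Suc k))) < \<infinity>" for k
  proof -
    obtain u where u: "u \<in> block_space p (b (Suc k))" "r (b (Suc k)) u < \<infinity>"
      using r_proper[of "b (Suc k)"] unfolding proper_on_def by blast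
    then have "ereal c + r (b (Suc k)) u < \<infinity>" for c by simp
    from le_less_trans[OF prox_step[OF u(1)] this] show ?thesis by auto
  qed
  have "r i (block_proj p i (x k)) < \<infinity>"
    using assms(2)
  proof (induction k rule: dec_induct)
    case base
    then show ?case using upd[of "j - 1"] assms by auto
  next
    case (step k)
    then show ?case using upd[of k] x_keep[of i k] by (cases "i = b (Suc k)") auto
  qed
  then show ?thesis
    using r_not_MInf[OF block_proj_mem, of i "x k"] unfolding R_def
    by (cases "r i (block_proj p i (x k))") auto
qed

text \<open>From index \<open>T\<close> on every block has been updated; this is the reason for the
  shift \<open>k + T\<close> in later statements.\<close>

lemma r_finite: "r i (block_proj p i (x (k + T))) = ereal (R (k + T) i)"
proof -
  obtain m where "m \<in> {Suc k..<Suc k + T}" "b m = i" using essentially_cyclic[of "Suc k" i] by auto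
  then show ?thesis by (intro r_updated[of m]) auto
qed

text \<open>The gradient of the smooth part of the proximal objective at the new block
  value.\<close>

definition prox_grad :: "nat \<Rightarrow> real ^ 'n" where
  "prox_grad k = hat_grad k
    + (2 * L (Suc k)) *\<^sub>R (block_proj p (b (Suc k)) (x (Suc k)) - hat k)"

text \<open>Minimality, with the squared distance expanded around the minimizer, is a quadratic
  minorant of \<open>r\<close> touching at the new block value.\<close>

lemma prox_model:
  assumes u: "u \<in> block_space p (b (Suc k))"
  defines "z \<equiv> block_proj p (b (Suc k)) (x (Suc k))"
  shows "ereal (R (Suc k) (b (Suc k)) - prox_grad k \<bullet> (u - z) - L (Suc k) * (norm (u - z))\<^sup>2) \<le> r (b (Suc k)) u"
proof -
  have rz: "r (b (Suc k)) z = ereal (R (Suc k) (b (Suc k)))"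
    unfolding z_def by (rule r_updated) auto
  have "(norm (u - hat k))\<^sup>2 = (norm (u - z))\<^sup>2 + 2 * ((z - hat k) \<bullet> (u - z)) + (norm (z - hat k))\<^sup>2"
    unfolding power2_norm_eq_inner by (simp add: inner_diff_left inner_diff_right inner_commute)
  then have eq: "hat_grad k \<bullet> (u - hat k) + L (Suc k) * (norm (u - hat k))\<^sup>2
      = hat_grad k \<bullet> (z - hat k) + L (Suc k) * (norm (z - hat k))\<^sup>2
        + prox_grad k \<bullet> (u - z) + L (Suc k) * (norm (u - z))\<^sup>2"
    by (simp add: prox_grad_def z_def inner_add_left inner_diff_right distrib_left right_diff_distrib)
  show ?thesis
    using prox_step[OF u] rz unfolding z_def[symmetric] eq
    by (cases "r (b (Suc k)) u") auto
qed

subsection \<open>Sufficient decrease\<close>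

text \<open>Real-valued form of the objective. It agrees with it once all blocks are updated; before
  that, \<open>R\<close> may replace an infinite value by 0.\<close>

definition \<phi> :: "nat \<Rightarrow> real" where
  "\<phi> k = f (x k) + (\<Sum>i\<in>UNIV. R k i)"

lemma objective_iterate: "objective p f r (x (k + T)) = ereal (\<phi> (k + T))"
  by (simp add: objective_def r_finite \<phi>_def)

text \<open>The step lies in the updated block, so the block Lipschitz constant suffices in the
  descent lemma.\<close>

lemma f_step:
  "f (x (Suc k)) - f (x k)
    \<le> gradf (x k) \<bullet> (x (Suc k) - x k) + L (Suc k) / 2 * (norm (x (Suc k) - x k))\<^sup>2"
proof -
  define i d where "i = b (Suc k)" and "d = x (Suc k) - x k"
  have d: "block_proj p i d = d" using step_in_block by (simp add: i_def d_def)
  then have di: "d \<in> block_space p i" by (metis block_proj_mem)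
  have "f (x k + d) - f (x k) \<le> gradf (x k) \<bullet> d + (L (Suc k) * (norm d)\<^sup>2) / 2"
  proof (rule smooth_upper_bound[OF f_grad])
    fix t :: real assume t: "0 \<le> t" "t \<le> 1"
    define G where "G u = block_proj p i (gradf (block_subst p i (x k) u))" for u
    let ?u = "block_proj p i (x k)"
    have lip: "(L (Suc k))-lipschitz_on (block_space p i) G"
      using block_lipschitz[of "Suc k"] by (simp add: G_def i_def)
    have "dist (G (?u + t *\<^sub>R d)) (G ?u) \<le> L (Suc k) * dist (?u + t *\<^sub>R d) ?u"
      by (rule lipschitz_onD[OF lip]) (auto intro!: block_space_closed di)
    moreover have "block_subst p i (x k) (?u + t *\<^sub>R d) = x k + t *\<^sub>R d"
      "block_subst p i (x k) ?u = x k"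
      by (simp_all add: block_subst_eq block_proj_simps d)
    ultimately have le: "norm (block_proj p i (gradf (x k + t *\<^sub>R d) - gradf (x k))) \<le> L (Suc k) * (t * norm d)"
      using t by (simp add: G_def dist_norm block_proj_simps)
    have "(gradf (x k + t *\<^sub>R d) - gradf (x k)) \<bullet> d
        = d \<bullet> block_proj p i (gradf (x k + t *\<^sub>R d) - gradf (x k))"
      by (simp only: inner_block_proj[OF di] inner_commute)
    also have "\<dots> \<le> norm d * norm (block_proj p i (gradf (x k + t *\<^sub>R d) - gradf (x k)))"
      by (rule norm_cauchy_schwarz)
    also have "\<dots> \<le> norm d * (L (Suc k) * (t * norm d))"
      using le by (intro mult_left_mono) auto
    finally show "(gradf (x k + t *\<^sub>R d) - gradf (x k)) \<bullet> d \<le> t * (L (Suc k) * (norm d)\<^sup>2)"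
      by (simp add: power2_eq_square mult_ac)
  qed
  then show ?thesis by (simp add: d_def)
qed

lemma hat_grad_diff:
  "norm (hat_grad k - block_proj p (b (Suc k)) (gradf (x k)))
    \<le> L (Suc k) * (\<omega> (Suc k) * norm (last_step k (b (Suc k))))"
proof -
  define i where "i = b (Suc k)"
  let ?u = "block_proj p i (x k)"
  define G where "G u = block_proj p i (gradf (block_subst p i (x k) u))" for u
  have lip: "(L (Suc k))-lipschitz_on (block_space p i) G"
    using block_lipschitz[of "Suc k"] by (simp add: G_def i_def)
  have "dist (G (hat k)) (G ?u) \<le> L (Suc k) * dist (hat k) ?u"
    by (rule lipschitz_onD[OF lip]) (use hat_mem in \<open>auto simp: i_def\<close>)
  moreover have "block_subst p i (x k) ?u = x k" by (simp add: block_subst_eq)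
  moreover have "dist (hat k) ?u = \<omega> (Suc k) * norm (last_step k i)"
    using \<omega>_range[of "Suc k"] by (simp add: hat_def dist_norm i_def)
  ultimately show ?thesis by (simp add: G_def hat_grad_def hat_point_def i_def dist_norm)
qed

text \<open>Without extrapolation the gain is \<open>L / 2\<close> times the squared step.
  Extrapolation costs three cross terms \<open>L * \<omega> * e * D\<close>: two from the proximal
  center, one from the gradient taken at the extrapolated point.\<close>

lemma objective_step:
  fixes k
  defines "l \<equiv> k + T"
  defines "D \<equiv> norm (x (Suc l) - x l)" and "e \<equiv> norm (last_step l (b (Suc l)))"
  shows "L (Suc l) / 4 * D\<^sup>2 - \<delta>\<^sup>2 / 4 * last_L l (b (Suc l)) * e\<^sup>2 \<le> \<phi> l - \<phi> (Suc l)"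
proof -
  define i where "i = b (Suc l)"
  define d where "d = x (Suc l) - x l"
  define es where "es = last_step l i"
  let ?L = "L (Suc l)" and ?w = "\<omega> (Suc l)"
  have w: "0 \<le> ?w" using \<omega>_range[of "Suc l"] by simp
  have Dd: "D = norm d" by (simp add: D_def d_def)
  have d: "block_proj p i d = d" using step_in_block by (simp add: i_def d_def)
  then have di: "d \<in> block_space p i" by (metis block_proj_mem)
  let ?z = "block_proj p i (x (Suc l))"
  have zu: "block_proj p i (x l) - ?z = - d"
    using d by (metis block_proj_simps(2) d_def minus_diff_eq)
  \<comment> \<open>The proximal minorant is tested at the old block value.\<close>
  have "ereal (R (Suc l) i - prox_grad l \<bullet> (- d) - ?L * D\<^sup>2) \<le> ereal (R l i)"
    using prox_model[of "block_proj p i (x l)" l] r_finite[of i k] zu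
    by (simp add: i_def l_def D_def d_def norm_minus_commute)
  then have Rle: "R (Suc l) i + prox_grad l \<bullet> d - ?L * D\<^sup>2 \<le> R l i" by simp
  have "?z - hat l = d - ?w *\<^sub>R es"
    using zu by (simp add: hat_def i_def es_def algebra_simps)
  then have pg_eq: "prox_grad l = hat_grad l + (2 * ?L) *\<^sub>R (d - ?w *\<^sub>R es)"
    by (simp add: prox_grad_def i_def)
  have pg: "prox_grad l \<bullet> d = hat_grad l \<bullet> d + 2 * ?L * D\<^sup>2 - 2 * ?L * ?w * (es \<bullet> d)"
    unfolding pg_eq by (simp add: D_def d_def[symmetric] inner_add_left inner_diff_left
        power2_norm_eq_inner right_diff_distrib)
  have "gradf (x l) \<bullet> d - hat_grad l \<bullet> d = (block_proj p i (gradf (x l)) - hat_grad l) \<bullet> d"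
    using inner_block_proj[OF di, of "gradf (x l)"] by (simp add: inner_diff_left inner_diff_right inner_commute)
  also have "\<dots> \<le> norm (block_proj p i (gradf (x l)) - hat_grad l) * D"
    unfolding D_def d_def[symmetric] by (rule norm_cauchy_schwarz)
  also have "\<dots> \<le> ?L * (?w * e) * D"
    using hat_grad_diff[of l] by (intro mult_right_mono) (auto simp: i_def e_def D_def norm_minus_commute)
  finally have g: "gradf (x l) \<bullet> d - hat_grad l \<bullet> d \<le> ?L * (?w * e) * D" .
  have "es \<bullet> d \<le> e * D" unfolding es_def i_def e_def D_def d_def by (rule norm_cauchy_schwarz)
  then have ed: "2 * ?L * ?w * (es \<bullet> d) \<le> 2 * ?L * ?w * (e * D)"
    using w L_pos[of l] by (intro mult_left_mono) auto
  have "(\<Sum>j\<in>UNIV. R (Suc l) j) - (\<Sum>j\<in>UNIV. R l j) = R (Suc l) i - R l i"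
    by (rule sum_diff_single) (simp add: R_def x_keep i_def)
  then have "\<phi> l - \<phi> (Suc l) = f (x l) - f (x (Suc l)) + R l i - R (Suc l) i"
    by (simp add: \<phi>_def)
  then have *: "?L / 2 * D\<^sup>2 - 3 * ?L * ?w * e * D \<le> \<phi> l - \<phi> (Suc l)"
    using f_step[of l] Rle pg g ed unfolding D_def[symmetric] d_def[symmetric] Dd[symmetric]
    by (simp add: algebra_simps)
  \<comment> \<open>Completing the square halves the gain and leaves
    \<open>9 * L * \<omega>^2 * e^2\<close>; the factor \<open>1 / 6\<close> in the choice of the
    weights turns 9 into \<open>\<delta>^2 / 4\<close>.\<close>
  have "0 \<le> ?L * (D / 2 - 3 * ?w * e)\<^sup>2" using L_pos[of l] by simp
  moreover have "?L * (D / 2 - 3 * ?w * e)\<^sup>2 = ?L / 4 * D\<^sup>2 - 3 * ?L * ?w * e * D + 9 * (?L * ?w\<^sup>2) * e\<^sup>2"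
    by (simp add: power2_eq_square algebra_simps)
  moreover have "9 * (?L * ?w\<^sup>2) * e\<^sup>2 \<le> 9 * (\<delta>\<^sup>2 / 36 * last_L l i) * e\<^sup>2"
    using \<omega>_sq_le[of l] by (intro mult_right_mono mult_left_mono) (auto simp: i_def)
  ultimately show ?thesis using * by (simp add: i_def)
qed

definition energy :: "nat \<Rightarrow> real" where
  "energy k = (\<Sum>i\<in>UNIV. last_L k i / 4 * (norm (last_step k i))\<^sup>2)"

text \<open>By \<open>objective_step\<close>, any weight strictly between \<open>\<delta>\<^sup>2\<close> and \<open>1\<close> yields a decrease in both steps.\<close>

definition \<beta> :: real where "\<beta> = (1 + \<delta>\<^sup>2) / 2"

definition decrease_const :: real where "decrease_const = (1 - \<delta>\<^sup>2) * Lmin / 16"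

definition lyapunov :: "nat \<Rightarrow> real" where
  "lyapunov k = \<phi> k + \<beta> * energy k"

lemma \<delta>_sq: "0 \<le> \<delta>\<^sup>2" "\<delta>\<^sup>2 < 1"
  using \<delta>_range by (auto simp: power_less_one_iff)

lemma \<beta>_range: "0 < \<beta>" "\<beta> \<le> 1"
  using \<delta>_sq by (auto simp: \<beta>_def intro: add_pos_nonneg)

lemma decrease_const_pos: "0 < decrease_const"
  using \<delta>_sq L_bounds(1) by (simp add: decrease_const_def)

lemma energy_nonneg: "0 \<le> energy k"
  unfolding energy_def using last_L_pos by (intro sum_nonneg) (simp add: less_imp_le)

text \<open>After \<open>T\<close> iterations no arbitrary initial value \<open>L0 i\<close> is left
  in \<open>last_L\<close>.\<close>

lemma last_L_bounds: "Lmin \<le> last_L (k + T) i" "last_L (k + T) i \<le> Lmax"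
proof -
  obtain m where m: "m \<in> {Suc k..<Suc k + T}" "b m = i" using essentially_cyclic[of "Suc k" i] by auto
  have "Lmin \<le> last_L n i \<and> last_L n i \<le> Lmax" if "m \<le> n" for n
    using that
  proof (induction n rule: dec_induct)
    case base
    then show ?case using m L_pos[of "m - 1"] by (cases m) auto
  next
    case (step n)
    then show ?case using L_pos[of n] by auto
  qed
  from this[of "k + T"] m show "Lmin \<le> last_L (k + T) i" "last_L (k + T) i \<le> Lmax" by auto
qed

text \<open>Only the updated block changes the energy: its old step leaves the sum and pays for the
  extrapolation, while its new step enters.\<close>

lemma lyapunov_decrease:
  "decrease_const * (q (Suc (k + T)))\<^sup>2 \<le> lyapunov (k + T) - lyapunov (Suc (k + T))"
proof -
  define l where "l = k + T"
  define i where "i = b (Suc l)"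
  define D e where "D = norm (x (Suc l) - x l)" and "e = norm (last_step l i)"
  have "energy (Suc l) - energy l
      = last_L (Suc l) i / 4 * (norm (last_step (Suc l) i))\<^sup>2 - last_L l i / 4 * (norm (last_step l i))\<^sup>2"
    unfolding energy_def by (rule sum_diff_single) (simp add: last_step_keep i_def)
  also have "\<dots> = L (Suc l) / 4 * D\<^sup>2 - last_L l i / 4 * e\<^sup>2"
    by (simp add: i_def last_step_update D_def e_def)
  finally have en: "energy (Suc l) - energy l = L (Suc l) / 4 * D\<^sup>2 - last_L l i / 4 * e\<^sup>2" .
  have "L (Suc l) / 4 * D\<^sup>2 - \<delta>\<^sup>2 / 4 * last_L l i * e\<^sup>2 \<le> \<phi> l - \<phi> (Suc l)"
    using objective_step[of k] by (simp add: l_def i_def D_def e_def)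
  then have "L (Suc l) / 4 * D\<^sup>2 - \<delta>\<^sup>2 / 4 * last_L l i * e\<^sup>2 - \<beta> * (energy (Suc l) - energy l)
      \<le> lyapunov l - lyapunov (Suc l)"
    by (simp add: lyapunov_def algebra_simps)
  \<comment> \<open>The midpoint weight balances both gains:
    \<open>1 - \<beta> = \<beta> - \<delta>^2 = (1 - \<delta>^2) / 2\<close>.\<close>
  also have "L (Suc l) / 4 * D\<^sup>2 - \<delta>\<^sup>2 / 4 * last_L l i * e\<^sup>2 - \<beta> * (energy (Suc l) - energy l)
      = (1 - \<delta>\<^sup>2) / 8 * (L (Suc l) * D\<^sup>2 + last_L l i * e\<^sup>2)"
    unfolding en \<beta>_def by (simp add: field_simps)
  finally have *: "(1 - \<delta>\<^sup>2) / 8 * (L (Suc l) * D\<^sup>2 + last_L l i * e\<^sup>2) \<le> lyapunov l - lyapunov (Suc l)" .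
  have "(q (Suc l))\<^sup>2 = (D + e)\<^sup>2" by (simp add: q_def D_def e_def i_def)
  also have "\<dots> \<le> 2 * (D\<^sup>2 + e\<^sup>2)" using sum_squares_ge_zero[of "D - e" 0]
    by (simp add: power2_eq_square algebra_simps)
  finally have "Lmin * (q (Suc l))\<^sup>2 \<le> Lmin * (2 * (D\<^sup>2 + e\<^sup>2))"
    using L_bounds(1) by (intro mult_left_mono) auto
  also have "\<dots> \<le> 2 * (L (Suc l) * D\<^sup>2 + last_L l i * e\<^sup>2)"
  proof -
    have "Lmin * D\<^sup>2 \<le> L (Suc l) * D\<^sup>2" using L_pos by (intro mult_right_mono) auto
    moreover have "Lmin * e\<^sup>2 \<le> last_L l i * e\<^sup>2"
      using last_L_bounds by (intro mult_right_mono) (auto simp: l_def)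
    ultimately show ?thesis by (simp add: algebra_simps)
  qed
  finally have le: "Lmin * (q (Suc l))\<^sup>2 \<le> 2 * (L (Suc l) * D\<^sup>2 + last_L l i * e\<^sup>2)" .
  have "decrease_const * (q (Suc l))\<^sup>2 = (1 - \<delta>\<^sup>2) / 16 * (Lmin * (q (Suc l))\<^sup>2)"
    by (simp add: decrease_const_def)
  also have "\<dots> \<le> (1 - \<delta>\<^sup>2) / 16 * (2 * (L (Suc l) * D\<^sup>2 + last_L l i * e\<^sup>2))"
    using le \<delta>_sq by (intro mult_left_mono) auto
  also have "\<dots> = (1 - \<delta>\<^sup>2) / 8 * (L (Suc l) * D\<^sup>2 + last_L l i * e\<^sup>2)" by (simp add: field_simps)
  finally have "decrease_const * (q (Suc l))\<^sup>2 \<le> (1 - \<delta>\<^sup>2) / 8 * (L (Suc l) * D\<^sup>2 + last_L l i * e\<^sup>2)" .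
  then show ?thesis using * by (simp add: l_def)
qed

subsection \<open>Windows containing an update of every block\<close>

definition Q :: "nat \<Rightarrow> real" where
  "Q k = (\<Sum>j\<in>{k<..k + T}. q j)"

lemma Q_nonneg: "0 \<le> Q k"
  unfolding Q_def by (intro sum_nonneg q_nonneg)

lemma q_le_Q: "j \<in> {k<..k + T} \<Longrightarrow> q j \<le> Q k"
  unfolding Q_def using q_nonneg by (intro member_le_sum) auto

lemma dist_step_le: "dist (x (Suc k)) (x k) \<le> q (Suc k)"
  by (simp add: q_def dist_norm)

lemma window_dist_le:
  assumes "k \<le> j" "j \<le> k + T"
  shows "dist (x j) (x (k + T)) \<le> Q k"
proof -
  have "dist (x j) (x (j + n)) \<le> (\<Sum>l\<in>{j<..j + n}. q l)" for n
  proof (induction n)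
    case (Suc n)
    have "{j<..j + Suc n} = insert (Suc (j + n)) {j<..j + n}" by auto
    then show ?case
      using Suc dist_step_le[of "j + n"] dist_triangle2[of "x j" "x (j + Suc n)" "x (j + n)"] by simp
  qed simp
  from this[of "k + T - j"] have "dist (x j) (x (k + T)) \<le> (\<Sum>l\<in>{j<..k + T}. q l)" using assms by simp
  also have "\<dots> \<le> Q k" unfolding Q_def using assms q_nonneg by (intro sum_mono2) auto
  finally show ?thesis .
qed

text \<open>Start from any update of block \<open>i\<close> in the window and replace it by each
  later one; afterwards the block stays frozen.\<close>

lemma last_update:
  obtains j where "k \<le> j" "j < k + T" "b (Suc j) = i"
    "block_proj p i (x (k + T)) = block_proj p i (x (Suc j))"
    "last_step (k + T) i = x (Suc j) - x j"
proof -
  obtain m where m: "m \<in> {Suc k..<Suc k + T}" "b m = i" using essentially_cyclic[of "Suc k" i] by auto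
  then have "m \<le> k + T" by simp
  then have "\<exists>j\<ge>k. j < k + T \<and> b (Suc j) = i \<and> block_proj p i (x (k + T)) = block_proj p i (x (Suc j))
      \<and> last_step (k + T) i = x (Suc j) - x j"
  proof -
    have "\<exists>j\<ge>k. j < n \<and> b (Suc j) = i \<and> block_proj p i (x n) = block_proj p i (x (Suc j))
      \<and> last_step n i = x (Suc j) - x j" if "m \<le> n" for n
      using that
    proof (induction n rule: dec_induct)
      case base
      then show ?case using m last_step_update[of "m - 1"] by (intro exI[of _ "m - 1"]) auto
    next
      case (step n)
      show ?case
      proof (cases "b (Suc n) = i")
        case True
        then show ?thesis using m step last_step_update[of n] by (intro exI[of _ n]) auto
      next
        case False
        then show ?thesis using step x_keep[of i n] last_step_keep[of i n] by (metis less_Suc_eq)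
      qed
    qed
    then show ?thesis using \<open>m \<le> k + T\<close> by blast
  qed
  then show ?thesis using that by blast
qed

lemma energy_le: "energy (k + T) \<le> real CARD('s) * (Lmax / 4) * (Q k)\<^sup>2"
proof -
  have "last_L (k + T) i / 4 * (norm (last_step (k + T) i))\<^sup>2 \<le> Lmax / 4 * (Q k)\<^sup>2" for i
  proof (rule mult_mono)
    obtain j where j: "k \<le> j" "j < k + T" "last_step (k + T) i = x (Suc j) - x j"
      by (rule last_update)
    then have "norm (last_step (k + T) i) \<le> q (Suc j)" by (simp add: q_def)
    also have "\<dots> \<le> Q k" using j by (intro q_le_Q) auto
    finally show "(norm (last_step (k + T) i))\<^sup>2 \<le> (Q k)\<^sup>2" by (intro power_mono) auto
  qed (use last_L_bounds Lmax_pos in auto)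
  then have "energy (k + T) \<le> (\<Sum>i\<in>(UNIV::'s set). Lmax / 4 * (Q k)\<^sup>2)"
    unfolding energy_def by (intro sum_mono)
  then show ?thesis by simp
qed

text \<open>The minorant from the last update of block \<open>i\<close> still touches
  \<open>r i\<close> at the end of the window. Its gradient was taken at the extrapolated point
  \<open>w\<close>: one \<open>Q k\<close> accounts for extrapolation, one for the travel since. The
  proximal term is \<open>s\<close>.\<close>

lemma block_model:
  obtains w s where "dist w (x (k + T)) \<le> 2 * Q k" "norm s \<le> 2 * Lmax * Q k" "s \<in> block_space p i"
    "\<And>u. u \<in> block_space p i \<Longrightarrow>
       ereal (R (k + T) i - (block_proj p i (gradf w) + s) \<bullet> (u - block_proj p i (x (k + T)))
         - Lmax * (norm (u - block_proj p i (x (k + T))))\<^sup>2) \<le> r i u"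
proof -
  obtain j where j: "k \<le> j" "j < k + T" "b (Suc j) = i"
    "block_proj p i (x (k + T)) = block_proj p i (x (Suc j))"
    "last_step (k + T) i = x (Suc j) - x j"
    by (rule last_update)
  define s where "s = (2 * L (Suc j)) *\<^sub>R (block_proj p i (x (Suc j)) - hat j)"
  let ?e = "\<omega> (Suc j) *\<^sub>R last_step j i"
  have e: "norm ?e \<le> norm (last_step j i)" using norm_\<omega>_last_step_le[of j] j by simp
  have qQ: "q (Suc j) \<le> Q k" using j by (intro q_le_Q) auto
  have q: "q (Suc j) = norm (x (Suc j) - x j) + norm (last_step j i)" using j by (simp add: q_def)
  show ?thesis
  proof (rule that)
    have "dist (hat_point j) (x j) = norm ?e" using j by (simp add: hat_point_eq dist_norm)
    then have "dist (hat_point j) (x j) \<le> Q k"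
      using e q qQ norm_ge_zero[of "x (Suc j) - x j"] by linarith
    then show "dist (hat_point j) (x (k + T)) \<le> 2 * Q k"
      using window_dist_le[of k j] j dist_triangle[of "hat_point j" "x (k + T)" "x j"] by simp
    have "block_proj p i (x (Suc j)) - hat j = block_proj p i (x (Suc j) - x j) - ?e"
      using j by (simp add: hat_def block_proj_simps)
    then have "norm (block_proj p i (x (Suc j)) - hat j) = norm (block_proj p i (x (Suc j) - x j) - ?e)"
      by (rule arg_cong)
    then have "norm (block_proj p i (x (Suc j)) - hat j) \<le> norm (x (Suc j) - x j) + norm (last_step j i)"
      using e norm_block_proj_le[of p i "x (Suc j) - x j"]
        norm_triangle_ineq4[of "block_proj p i (x (Suc j) - x j)" ?e] by linarith
    then have "norm (block_proj p i (x (Suc j)) - hat j) \<le> Q k" using q qQ by linarith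
    then show "norm s \<le> 2 * Lmax * Q k"
      unfolding s_def using L_pos[of j] Lmax_pos by (auto intro!: mult_mono)
    show "s \<in> block_space p i"
      unfolding s_def using hat_mem[of j] j by (intro block_space_closed) auto
    fix u assume u: "u \<in> block_space p i"
    have "R (Suc j) i = R (k + T) i" using j by (simp add: R_def)
    moreover have "prox_grad j = block_proj p i (gradf (hat_point j)) + s"
      using j by (simp add: prox_grad_def hat_grad_def s_def)
    ultimately have "ereal (R (k + T) i - (block_proj p i (gradf (hat_point j)) + s) \<bullet> (u - block_proj p i (x (k + T)))
         - L (Suc j) * (norm (u - block_proj p i (x (k + T))))\<^sup>2) \<le> r i u"
      using prox_model[of u j] u j by simp
    moreover have "L (Suc j) * (norm (u - block_proj p i (x (k + T))))\<^sup>2 \<le> Lmax * (norm (u - block_proj p i (x (k + T))))\<^sup>2"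
      using L_pos by (intro mult_right_mono) auto
    ultimately show "ereal (R (k + T) i - (block_proj p i (gradf (hat_point j)) + s) \<bullet> (u - block_proj p i (x (k + T)))
         - Lmax * (norm (u - block_proj p i (x (k + T))))\<^sup>2) \<le> r i u"
      by (elim order_trans[rotated]) simp
  qed
qed

text \<open>The full gradient at the window end minus the block slopes is a subgradient of
  \<open>F\<close>. The slopes use gradients at older points \<open>w i\<close>; as
  \<open>\<rho> + 2 * Q k < 4 * \<rho>\<close>, these lie in the ball where the local Lipschitz
  bound applies.\<close>

lemma subgradient_bound:
  assumes lip: "\<And>i. K-lipschitz_on (ball xbar (4 * \<rho>)) (\<lambda>z. block_proj p i (gradf z))"
    and near: "x (k + T) \<in> ball xbar \<rho>" "2 * Q k < 3 * \<rho>"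
  obtains g where "g \<in> limiting_subdiff (objective p f r) (x (k + T))"
    "norm g \<le> real CARD('s) * (2 * K + 2 * Lmax) * Q k"
proof -
  let ?X = "x (k + T)"
  have "\<forall>i. \<exists>w s. dist w ?X \<le> 2 * Q k \<and> norm s \<le> 2 * Lmax * Q k \<and> s \<in> block_space p i \<and>
    (\<forall>u\<in>block_space p i. ereal (R (k + T) i - (block_proj p i (gradf w) + s) \<bullet> (u - block_proj p i ?X)
         - Lmax * (norm (u - block_proj p i ?X))\<^sup>2) \<le> r i u)"
    using block_model by metis
  then obtain w s where ws: "\<And>i. dist (w i) ?X \<le> 2 * Q k" "\<And>i. norm (s i) \<le> 2 * Lmax * Q k"
    "\<And>i. s i \<in> block_space p i"
    "\<And>i u. u \<in> block_space p i \<Longrightarrow> ereal (R (k + T) i - (block_proj p i (gradf (w i)) + s i) \<bullet> (u - block_proj p i ?X)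
         - Lmax * (norm (u - block_proj p i ?X))\<^sup>2) \<le> r i u"
    by metis
  define v where "v i = block_proj p i (gradf (w i)) + s i" for i
  have "gradf ?X - (\<Sum>i\<in>UNIV. v i) \<in> frechet_subdiff (objective p f r) ?X"
    using ws Lmax_pos
    by (intro objective_frechet_subgradient[OF f_grad, where R = "R (k + T)" and M = Lmax])
      (auto simp: v_def r_finite intro!: block_space_closed)
  then have mem: "gradf ?X - (\<Sum>i\<in>UNIV. v i) \<in> limiting_subdiff (objective p f r) ?X"
    using frechet_subset_limiting by blast
  have "norm (block_proj p i (gradf ?X) - v i) \<le> (2 * K + 2 * Lmax) * Q k" for i
  proof -
    have X: "?X \<in> ball xbar (4 * \<rho>)" using near Q_nonneg[of k] by simp
    moreover have "w i \<in> ball xbar (4 * \<rho>)"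
      using near ws(1)[of i] dist_triangle[of xbar "w i" ?X] by (simp add: dist_commute)
    ultimately have "dist (block_proj p i (gradf ?X)) (block_proj p i (gradf (w i))) \<le> K * dist ?X (w i)"
      by (intro lipschitz_onD[OF lip])
    also have "\<dots> \<le> K * (2 * Q k)"
      using ws(1)[of i] lipschitz_on_nonneg[OF lip] by (intro mult_left_mono) (auto simp: dist_commute)
    finally have "norm (block_proj p i (gradf ?X) - block_proj p i (gradf (w i))) \<le> K * (2 * Q k)"
      by (simp add: dist_norm)
    moreover have "block_proj p i (gradf ?X) - v i
        = (block_proj p i (gradf ?X) - block_proj p i (gradf (w i))) - s i" by (simp add: v_def)
    ultimately show ?thesis
      using ws(2)[of i] norm_triangle_ineq4[of "block_proj p i (gradf ?X) - block_proj p i (gradf (w i))" "s i"]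
      by (simp add: algebra_simps)
  qed
  then have "(\<Sum>i\<in>UNIV. norm (block_proj p i (gradf ?X) - v i)) \<le> (\<Sum>i\<in>(UNIV::'s set). (2 * K + 2 * Lmax) * Q k)"
    by (intro sum_mono)
  moreover have "gradf ?X - (\<Sum>i\<in>UNIV. v i) = (\<Sum>i\<in>UNIV. block_proj p i (gradf ?X) - v i)"
    by (simp add: sum_subtractf sum_block_proj)
  ultimately have "norm (gradf ?X - (\<Sum>i\<in>UNIV. v i)) \<le> real CARD('s) * (2 * K + 2 * Lmax) * Q k"
    using norm_sum[of "\<lambda>i. block_proj p i (gradf ?X) - v i" UNIV] by simp
  then show ?thesis using mem that by blast
qed

end

section \<open>Limits of the iteration and the KL error bound\<close>

locale bpl_kl = bpl p f gradf r x b \<omega> \<alpha> L L0 Lmin Lmax \<delta> T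
  for p :: "'n::finite \<Rightarrow> 's::finite" and f gradf r x b \<omega> \<alpha> L L0 Lmin Lmax \<delta> T +
  fixes xbar :: "real ^ 'n" and \<rho> \<eta> \<theta> :: real
  assumes F_decreasing: "\<And>k. k \<ge> 1 \<Longrightarrow> objective p f r (x k) \<le> objective p f r (x (k - 1))"
    and limit_point: "\<exists>\<sigma>. strict_mono \<sigma> \<and> (x \<circ> \<sigma>) \<longlonglongrightarrow> xbar"
    and KL: "KL_property (objective p f r) xbar \<rho> \<eta> \<theta>"
    and local_lipschitz: "\<And>i. \<exists>K. K-lipschitz_on (ball xbar (4 * \<rho>)) (\<lambda>z. block_proj p i (gradf z))"
begin

lemma \<phi>_decreasing: "\<phi> (Suc k + T) \<le> \<phi> (k + T)"
  using F_decreasing[of "Suc k + T"] objective_iterate[of k] objective_iterate[of "Suc k"] by simp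

lemma decseq_\<phi>: "decseq (\<lambda>k. \<phi> (k + T))"
  using \<phi>_decreasing by (intro decseq_SucI)

text \<open>The Lyapunov values decrease and are bounded below, so their decrements, which dominate
  a multiple of the square of \<open>q\<close>, tend to 0.\<close>

lemma q_null: "q \<longlonglongrightarrow> 0"
proof -
  obtain m where m: "\<And>z. z \<in> eff_dom (objective p f r) \<Longrightarrow> ereal m \<le> objective p f r z"
    using F_bounded_below by blast
  have "m \<le> lyapunov (k + T)" for k
  proof -
    have "m \<le> \<phi> (k + T)" using m[of "x (k + T)"] objective_iterate[of k] by (simp add: eff_dom_def)
    moreover have "0 \<le> \<beta> * energy (k + T)" using \<beta>_range energy_nonneg by simp
    ultimately show ?thesis by (simp add: lyapunov_def)
  qed
  moreover have dec: "0 \<le> decrease_const * (q (Suc (k + T)))\<^sup>2" for k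
    using decrease_const_pos by simp
  have "decseq (\<lambda>k. lyapunov (k + T))"
    using order_trans[OF dec lyapunov_decrease] by (intro decseq_SucI) simp
  ultimately obtain l where "(\<lambda>k. lyapunov (k + T)) \<longlonglongrightarrow> l"
    using decseq_convergent by metis
  then have "(\<lambda>k. lyapunov (k + T) - lyapunov (Suc k + T)) \<longlonglongrightarrow> l - l"
    by (intro tendsto_diff LIMSEQ_Suc)
  then have "(\<lambda>k. lyapunov (k + T) - lyapunov (Suc (k + T))) \<longlonglongrightarrow> 0" by simp
  then have "(\<lambda>k. decrease_const * (q (Suc (k + T)))\<^sup>2) \<longlonglongrightarrow> 0"
    by (rule squeeze_zero) (use dec lyapunov_decrease in auto)
  then have "(\<lambda>k. sqrt (decrease_const * (q (Suc (k + T)))\<^sup>2 / decrease_const)) \<longlonglongrightarrow> sqrt (0 / decrease_const)"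
    by (intro tendsto_real_sqrt tendsto_divide tendsto_const) (use decrease_const_pos in auto)
  moreover have "sqrt (decrease_const * (q (Suc (k + T)))\<^sup>2 / decrease_const) = q (k + Suc T)" for k
    using decrease_const_pos q_nonneg by simp
  ultimately have "(\<lambda>k. q (k + Suc T)) \<longlonglongrightarrow> 0" by simp
  then show ?thesis by (rule LIMSEQ_offset)
qed

lemma Q_null: "Q \<longlonglongrightarrow> 0"
proof -
  have "Q = (\<lambda>k. \<Sum>l\<in>{0<..T}. q (k + l))"
  proof
    fix k
    show "Q k = (\<Sum>l\<in>{0<..T}. q (k + l))"
      unfolding Q_def by (rule sum.reindex_bij_witness[of _ "\<lambda>l. k + l" "\<lambda>j. j - k"]) auto
  qed
  moreover have "(\<lambda>k. \<Sum>l\<in>{0<..T}. q (k + l)) \<longlonglongrightarrow> 0"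
    by (intro tendsto_null_sum LIMSEQ_ignore_initial_segment q_null)
  ultimately show ?thesis by simp
qed

lemma energy_null: "energy \<longlonglongrightarrow> 0"
proof -
  have "(\<lambda>k. real CARD('s) * (Lmax / 4) * (Q k)\<^sup>2) \<longlonglongrightarrow> real CARD('s) * (Lmax / 4) * 0\<^sup>2"
    by (intro tendsto_intros Q_null)
  then have "(\<lambda>k. real CARD('s) * (Lmax / 4) * (Q k)\<^sup>2) \<longlonglongrightarrow> 0" by simp
  then have "(\<lambda>k. energy (k + T)) \<longlonglongrightarrow> 0"
    by (rule squeeze_zero) (use energy_nonneg energy_le in auto)
  then show ?thesis by (rule LIMSEQ_offset)
qed

text \<open>The proximal models give \<open>limsup r\<^sub>i(x\<^sub>i) \<le> r\<^sub>i(xbar\<^sub>i)\<close> along the subsequence, and lower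
  semicontinuity the converse inequality.\<close>

lemma block_value_limit:
  assumes \<kappa>: "filterlim \<kappa> sequentially sequentially" and lim: "(\<lambda>n. x (\<kappa> n + T)) \<longlonglongrightarrow> xbar"
  obtains R' where "r i (block_proj p i xbar) = ereal R'" "(\<lambda>n. R (\<kappa> n + T) i) \<longlonglongrightarrow> R'"
proof -
  let ?z = "\<lambda>n. block_proj p i (x (\<kappa> n + T))" and ?zbar = "block_proj p i xbar"
  have "\<exists>w s. dist w (x (k + T)) \<le> 2 * Q k \<and> norm s \<le> 2 * Lmax * Q k \<and>
    (\<forall>u\<in>block_space p i. ereal (R (k + T) i - (block_proj p i (gradf w) + s) \<bullet> (u - block_proj p i (x (k + T)))
         - Lmax * (norm (u - block_proj p i (x (k + T))))\<^sup>2) \<le> r i u)" for k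
    by (rule block_model[of k i]) blast
  then obtain w s where ws: "\<And>k. dist (w k) (x (k + T)) \<le> 2 * Q k \<and> norm (s k) \<le> 2 * Lmax * Q k \<and>
    (\<forall>u\<in>block_space p i. ereal (R (k + T) i - (block_proj p i (gradf (w k)) + s k) \<bullet> (u - block_proj p i (x (k + T)))
         - Lmax * (norm (u - block_proj p i (x (k + T))))\<^sup>2) \<le> r i u)"
    by metis
  then have w: "\<And>k. dist (w k) (x (k + T)) \<le> 2 * Q k" and s: "\<And>k. norm (s k) \<le> 2 * Lmax * Q k"
    by blast+
  have Q\<kappa>: "(\<lambda>n. Q (\<kappa> n)) \<longlonglongrightarrow> 0" using Q_null \<kappa> by (rule filterlim_compose)
  have z: "?z \<longlonglongrightarrow> ?zbar" using lim by (rule tendsto_block_proj)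
  have "(\<lambda>n. dist (w (\<kappa> n)) (x (\<kappa> n + T))) \<longlonglongrightarrow> 0"
    by (rule squeeze_zero[OF tendsto_mult_right_zero[OF Q\<kappa>, of 2]]) (use w in auto)
  then have "(\<lambda>n. w (\<kappa> n) - x (\<kappa> n + T)) \<longlonglongrightarrow> 0" unfolding dist_norm by (rule tendsto_norm_zero_cancel)
  from tendsto_add[OF this lim] have wlim: "(\<lambda>n. w (\<kappa> n)) \<longlonglongrightarrow> xbar" by simp
  have "isCont gradf xbar" using f_C1 by (simp add: continuous_on_eq_continuous_at)
  from isCont_tendsto_compose[OF this wlim] have glim: "(\<lambda>n. block_proj p i (gradf (w (\<kappa> n)))) \<longlonglongrightarrow> block_proj p i (gradf xbar)"
    by (rule tendsto_block_proj)
  have "(\<lambda>n. norm (s (\<kappa> n))) \<longlonglongrightarrow> 0"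
    by (rule squeeze_zero[OF tendsto_mult_right_zero[OF Q\<kappa>, of "2 * Lmax"]]) (use s in auto)
  then have slim: "(\<lambda>n. s (\<kappa> n)) \<longlonglongrightarrow> 0" by (rule tendsto_norm_zero_cancel)
  \<comment> \<open>The model inequality at a point \<open>u\<close> with finite value
    \<open>c\<close>, solved for the block value \<open>R\<close>.\<close>
  define h where "h c u n = c + (block_proj p i (gradf (w (\<kappa> n))) + s (\<kappa> n)) \<bullet> (u - ?z n)
      + Lmax * (norm (u - ?z n))\<^sup>2" for c u n
  have R_le: "R (\<kappa> n + T) i \<le> h c u n" if "u \<in> block_space p i" "r i u = ereal c" for n u c
    using ws[of "\<kappa> n", THEN conjunct2, THEN conjunct2, THEN bspec, OF that(1)] that(2) by (simp add: h_def)
  have h_lim: "h c u \<longlonglongrightarrow> c + (block_proj p i (gradf xbar) + 0) \<bullet> (u - ?zbar) + Lmax * (norm (u - ?zbar))\<^sup>2" for c u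
    unfolding h_def[abs_def] by (intro tendsto_intros glim slim z)
  have lsc: "\<forall>\<^sub>F n in sequentially. y < R (\<kappa> n + T) i" if "ereal y < r i ?zbar" for y
    using lsc_on_sequence[OF r_lsc block_proj_mem z block_proj_mem that] by (simp add: r_finite)
  obtain u where u: "u \<in> block_space p i" "r i u < \<infinity>" using r_proper[of i] unfolding proper_on_def by blast
  then obtain c where c: "r i u = ereal c" using r_not_MInf[of u i] by (cases "r i u") auto
  \<comment> \<open>Otherwise lower semicontinuity would push \<open>R\<close> to infinity, against
    the convergent upper bound from a point of the domain.\<close>
  have "r i ?zbar \<noteq> \<infinity>"
  proof
    assume inf: "r i ?zbar = \<infinity>"
    let ?l = "c + (block_proj p i (gradf xbar) + 0) \<bullet> (u - ?zbar) + Lmax * (norm (u - ?zbar))\<^sup>2"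
    have "\<forall>\<^sub>F n in sequentially. h c u n < ?l + 1" by (rule order_tendstoD[OF h_lim]) simp
    moreover have "\<forall>\<^sub>F n in sequentially. ?l + 1 < R (\<kappa> n + T) i" using inf by (intro lsc) simp
    ultimately have "\<forall>\<^sub>F n in sequentially. False"
    proof eventually_elim
      case (elim n)
      then show ?case using R_le[OF u(1) c, of n] by linarith
    qed
    then show False by simp
  qed
  then obtain R' where R': "r i ?zbar = ereal R'"
    using r_not_MInf[OF block_proj_mem, of i xbar] by (cases "r i ?zbar") auto
  have "(\<lambda>n. R (\<kappa> n + T) i) \<longlonglongrightarrow> R'"
  proof (rule order_tendstoI)
    fix y assume "y < R'"
    then show "\<forall>\<^sub>F n in sequentially. y < R (\<kappa> n + T) i" using R' by (intro lsc) simp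
  next
    fix y assume "R' < y"
    moreover have "h R' ?zbar \<longlonglongrightarrow> R'" using h_lim[of R' ?zbar] by simp
    ultimately have "\<forall>\<^sub>F n in sequentially. h R' ?zbar n < y" by (intro order_tendstoD)
    then show "\<forall>\<^sub>F n in sequentially. R (\<kappa> n + T) i < y"
    proof eventually_elim
      case (elim n)
      then show ?case using R_le[OF block_proj_mem R', of n] by linarith
    qed
  qed
  then show ?thesis using that R' by blast
qed

text \<open>Along the subsequence the objective tends to its value at \<open>xbar\<close>;
  monotonicity carries this over to the whole sequence.\<close>

lemma objective_limit:
  obtains \<phi>' where "objective p f r xbar = ereal \<phi>'" "(\<lambda>k. \<phi> (k + T)) \<longlonglongrightarrow> \<phi>'"
    "\<And>k. \<phi>' \<le> \<phi> (k + T)"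
proof -
  obtain \<sigma> where \<sigma>: "strict_mono \<sigma>" "(x \<circ> \<sigma>) \<longlonglongrightarrow> xbar" using limit_point by blast
  \<comment> \<open>The subsequence is re-indexed so that its indices have the form
    \<open>\<kappa> n + T\<close>, where all values are finite; the subtraction is exact because
    \<open>n + T \<le> \<sigma> (n + T)\<close>.\<close>
  define \<kappa> where "\<kappa> n = \<sigma> (n + T) - T" for n
  have \<kappa>T: "\<kappa> n + T = \<sigma> (n + T)" for n
    using seq_suble[OF \<sigma>(1), of "n + T"] by (simp add: \<kappa>_def)
  have "n \<le> \<kappa> n" for n using seq_suble[OF \<sigma>(1), of "n + T"] by (simp add: \<kappa>_def)
  then have \<kappa>: "filterlim \<kappa> sequentially sequentially"
    by (intro filterlim_at_top_mono[OF filterlim_ident]) auto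
  have lim: "(\<lambda>n. x (\<kappa> n + T)) \<longlonglongrightarrow> xbar"
    using LIMSEQ_ignore_initial_segment[OF \<sigma>(2), of T] by (simp add: \<kappa>T)
  have "\<exists>R'. r i (block_proj p i xbar) = ereal R' \<and> (\<lambda>n. R (\<kappa> n + T) i) \<longlonglongrightarrow> R'" for i
    by (rule block_value_limit[OF \<kappa> lim, of i]) blast
  then obtain R' where R': "\<And>i. r i (block_proj p i xbar) = ereal (R' i)"
    "\<And>i. (\<lambda>n. R (\<kappa> n + T) i) \<longlonglongrightarrow> R' i" by metis
  define \<phi>' where "\<phi>' = f xbar + (\<Sum>i\<in>UNIV. R' i)"
  have "isCont f xbar"
    using f_grad[of xbar] unfolding gderiv_def by (rule has_derivative_continuous)
  from isCont_tendsto_compose[OF this lim] have "(\<lambda>n. f (x (\<kappa> n + T))) \<longlonglongrightarrow> f xbar" .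
  then have sub: "(\<lambda>n. \<phi> (\<kappa> n + T)) \<longlonglongrightarrow> \<phi>'"
    unfolding \<phi>_def \<phi>'_def by (intro tendsto_intros R')
  have ge: "\<phi>' \<le> \<phi> (k + T)" for k
  proof (rule tendsto_upperbound[OF sub])
    have "\<forall>\<^sub>F n in sequentially. k \<le> \<kappa> n" using \<kappa> by (simp add: filterlim_at_top)
    then show "\<forall>\<^sub>F n in sequentially. \<phi> (\<kappa> n + T) \<le> \<phi> (k + T)"
      by eventually_elim (use decseqD[OF decseq_\<phi>] in blast)
  qed simp
  obtain l where l: "(\<lambda>k. \<phi> (k + T)) \<longlonglongrightarrow> l"
    using decseq_convergent[OF decseq_\<phi>, of \<phi>'] ge by metis
  then have "(\<lambda>n. \<phi> (\<kappa> n + T)) \<longlonglongrightarrow> l" using \<kappa> by (rule filterlim_compose)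
  then have "l = \<phi>'" using sub by (rule LIMSEQ_unique)
  moreover have "objective p f r xbar = ereal \<phi>'" by (simp add: objective_def R' \<phi>'_def)
  ultimately show ?thesis using that l ge by blast
qed

text \<open>The error bound splits the potential into its objective part, controlled by the KL
  inequality, and its energy part, controlled by the steps of the window.\<close>

lemma kl_descent_exists:
  obtains \<Phi> c k0 where "kl_descent x xbar \<Phi> q decrease_const c \<rho> (max \<theta> (1 / 2)) k0 T"
proof -
  obtain \<phi>' where \<phi>': "objective p f r xbar = ereal \<phi>'" "(\<lambda>k. \<phi> (k + T)) \<longlonglongrightarrow> \<phi>'"
    "\<And>k. \<phi>' \<le> \<phi> (k + T)" using objective_limit by blast
  obtain c where c: "0 < c" and kl: "\<And>z g t s. z \<in> ball xbar \<rho> \<Longrightarrow> g \<in> limiting_subdiff (objective p f r) z \<Longrightarrow>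
       objective p f r xbar = ereal s \<Longrightarrow> objective p f r z = ereal (s + t) \<Longrightarrow> 0 < t \<Longrightarrow> t < \<eta> \<Longrightarrow>
       t powr \<theta> \<le> c * norm g"
    using KL_property_powr_bound[OF KL] by blast
  have KL_range: "0 < \<rho>" "0 < \<eta>" "0 \<le> \<theta>" "\<theta> < 1" using KL by (auto simp: KL_property_def)
  define \<theta>' where "\<theta>' = max \<theta> (1 / 2)"
  have \<theta>': "1 / 2 \<le> \<theta>'" "\<theta> \<le> \<theta>'" "\<theta>' < 1" using KL_range by (auto simp: \<theta>'_def)
  obtain K where lip: "\<And>i. K-lipschitz_on (ball xbar (4 * \<rho>)) (\<lambda>z. block_proj p i (gradf z))"
  proof -
    obtain K where K: "\<And>i. (K i)-lipschitz_on (ball xbar (4 * \<rho>)) (\<lambda>z. block_proj p i (gradf z))"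
      using local_lipschitz by metis
    have "K i \<le> (\<Sum>i\<in>UNIV. K i)" for i
      using lipschitz_on_nonneg[OF K] by (intro member_le_sum) auto
    then show ?thesis by (intro that lipschitz_on_mono[OF K order_refl])
  qed
  have K: "0 \<le> K" using lipschitz_on_nonneg[OF lip] .
  define \<Phi> where "\<Phi> k = lyapunov k - \<phi>'" for k
  have \<Phi>_eq: "\<Phi> k = (\<phi> k - \<phi>') + \<beta> * energy k" for k by (simp add: \<Phi>_def lyapunov_def)
  have \<phi>_lim: "\<phi> \<longlonglongrightarrow> \<phi>'" using \<phi>'(2) by (rule LIMSEQ_offset)
  define C where "C = real CARD('s) * (2 * K + 2 * Lmax)"
  define E where "E = sqrt (real CARD('s) * (Lmax / 4))"
  have C: "0 \<le> C" and E: "0 \<le> E" using K Lmax_pos by (auto simp: C_def E_def)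
  \<comment> \<open>The bound \<open>\<eta>\<close> admits the KL inequality, the two bounds 1 allow
    comparing powers, and \<open>3 * \<rho> / 2\<close> serves
    \<open>subgradient_bound\<close>.\<close>
  have "\<forall>\<^sub>F k in sequentially. \<phi> k < \<phi>' + min 1 \<eta>"
    using KL_range by (intro order_tendstoD(2)[OF \<phi>_lim]) auto
  moreover have "\<forall>\<^sub>F k in sequentially. energy k < 1" by (intro order_tendstoD(2)[OF energy_null]) simp
  moreover have "\<forall>\<^sub>F k in sequentially. Q k < 3 * \<rho> / 2"
    using KL_range by (intro order_tendstoD(2)[OF Q_null]) simp
  ultimately have "\<forall>\<^sub>F k in sequentially. \<phi> k < \<phi>' + min 1 \<eta> \<and> energy k < 1 \<and> Q k < 3 * \<rho> / 2"
    by eventually_elim simp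
  then obtain N where N: "\<And>k. N \<le> k \<Longrightarrow> \<phi> k < \<phi>' + min 1 \<eta> \<and> energy k < 1 \<and> Q k < 3 * \<rho> / 2"
    by (auto simp: eventually_sequentially)
  have "kl_descent x xbar \<Phi> q decrease_const (2 * (c * C + E)) \<rho> \<theta>' (N + T) T"
  proof
    have "(\<lambda>k. (\<phi> k - \<phi>') + \<beta> * energy k) \<longlonglongrightarrow> (\<phi>' - \<phi>') + \<beta> * 0"
      by (intro tendsto_intros \<phi>_lim energy_null)
    then show "\<Phi> \<longlonglongrightarrow> 0" by (simp add: \<Phi>_eq[abs_def])
    show "0 \<le> 2 * (c * C + E)" using c C E by simp
    fix k assume k: "N + T \<le> k"
    then obtain l where l: "k = l + T" "N \<le> l" using that[of "k - T"] by auto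
    show "0 \<le> \<Phi> k"
      unfolding \<Phi>_eq using \<phi>'(3)[of l] energy_nonneg \<beta>_range by (simp add: l)
    show "decrease_const * (q (Suc k))\<^sup>2 \<le> \<Phi> k - \<Phi> (Suc k)"
      using lyapunov_decrease[of l] by (simp add: \<Phi>_def l)
    assume ball: "\<And>j. j \<in> {k..k + T} \<Longrightarrow> x j \<in> ball xbar \<rho>"
    define t where "t = \<phi> (k + T) - \<phi>'"
    have t: "0 \<le> t" "t < 1" "t < \<eta>" using \<phi>'(3)[of k] N[of "k + T"] k by (auto simp: t_def)
    have kl_part: "t powr \<theta>' \<le> c * C * Q k"
    \<comment> \<open>The KL inequality says nothing at the limit value itself, but there the left
      side is 0.\<close>
    proof (cases "t = 0")
      case True
      then show ?thesis using c C Q_nonneg by simp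
    next
      case False
      then have t_pos: "0 < t" using t by simp
      obtain g where g: "g \<in> limiting_subdiff (objective p f r) (x (k + T))" "norm g \<le> C * Q k"
        using subgradient_bound[OF lip, of k] ball[of "k + T"] N[of k] k by (auto simp: C_def)
      have "t powr \<theta>' \<le> t powr \<theta>" using t \<theta>' False by (intro powr_mono') auto
      also have "\<dots> \<le> c * norm g"
        using g ball[of "k + T"] \<phi>'(1) t t_pos
        by (intro kl[of "x (k + T)" g \<phi>']) (auto simp: objective_iterate t_def)
      also have "\<dots> \<le> c * (C * Q k)" using g c by (intro mult_left_mono) auto
      finally show ?thesis by (simp add: mult.assoc)
    qed
    have "\<beta> * energy (k + T) \<le> energy (k + T)"
      using \<beta>_range energy_nonneg by (simp add: mult_left_le_one_le)
    then have "(\<beta> * energy (k + T)) powr \<theta>' \<le> energy (k + T) powr \<theta>'"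
      using \<beta>_range energy_nonneg \<theta>' by (intro powr_mono2) auto
    also have "\<dots> \<le> energy (k + T) powr (1 / 2)"
      using \<theta>' N[of "k + T"] k energy_nonneg[of "k + T"]
      by (cases "energy (k + T) = 0") (auto intro!: powr_mono')
    also have "\<dots> = sqrt (energy (k + T))" using energy_nonneg by (simp add: powr_half_sqrt)
    also have "\<dots> \<le> sqrt (real CARD('s) * (Lmax / 4) * (Q k)\<^sup>2)" using energy_le by simp
    also have "\<dots> = E * Q k" using Q_nonneg[of k] by (simp only: E_def real_sqrt_mult real_sqrt_abs abs_of_nonneg)
    finally have energy_part: "(\<beta> * energy (k + T)) powr \<theta>' \<le> E * Q k" .
    have "\<Phi> (k + T) powr \<theta>' \<le> 2 * (t powr \<theta>' + (\<beta> * energy (k + T)) powr \<theta>')"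
      unfolding \<Phi>_eq t_def[symmetric] using t \<beta>_range energy_nonneg \<theta>' by (intro powr_add_le) auto
    then show "\<Phi> (k + T) powr \<theta>' \<le> 2 * (c * C + E) * (\<Sum>j\<in>{k<..k + T}. q j)"
      using kl_part energy_part unfolding Q_def[symmetric] by (simp add: algebra_simps)
  qed (use KL_range T_pos \<theta>' decrease_const_pos q_nonneg dist_step_le limit_point in auto)
  then show ?thesis using that by (simp add: \<theta>'_def)
qed

end

theorem theorem2p9:
  fixes p :: "'n::finite \<Rightarrow> 's::finite"
    and f :: "real ^ 'n \<Rightarrow> real"
    and gradf :: "real ^ 'n \<Rightarrow> real ^ 'n"
    and r :: "'s \<Rightarrow> real ^ 'n \<Rightarrow> ereal"
    and F :: "real ^ 'n \<Rightarrow> ereal"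
    and x :: "nat \<Rightarrow> real ^ 'n"
    and xbar :: "real ^ 'n"
    and b :: "nat \<Rightarrow> 's"
    and \<omega> \<alpha> L :: "nat \<Rightarrow> real"
    and L0 :: "'s \<Rightarrow> real"
    and Lmin Lmax \<delta> \<rho> \<eta> \<theta> :: real
    and T :: nat
  assumes F_def: "F = objective p f r"
    \<comment> \<open>Assumption 1\<close>
    and f_grad: "\<And>z. GDERIV f z :> gradf z"
    and f_C1: "continuous_on UNIV gradf"
    and r_proper: "\<And>i. proper_on (block_space p i) (r i)"
    and r_lsc: "\<And>i. lsc_on (block_space p i) (r i)"
    and F_proper: "proper_on UNIV F"
    and F_bounded_below: "\<exists>m::real. \<forall>z\<in>eff_dom F. ereal m \<le> F z"
    and F_critical: "\<exists>z. 0 \<in> limiting_subdiff F z"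
    \<comment> \<open>the iterates\<close>
    and bpl: "BPL_sequence p gradf r b \<omega> \<alpha> x"
    and \<omega>_range: "\<And>k. k \<ge> 1 \<Longrightarrow> 0 \<le> \<omega> k \<and> \<omega> k \<le> 1"
    \<comment> \<open>Assumption 2\<close>
    and block_lipschitz: "\<And>k. k \<ge> 1 \<Longrightarrow>
          (L k)-lipschitz_on (block_space p (b k))
            (\<lambda>u. block_proj p (b k) (gradf (block_subst p (b k) (x (k - 1)) u)))"
    and L_bounds: "0 < Lmin" "\<And>k. k \<ge> 1 \<Longrightarrow> Lmin \<le> L k \<and> L k \<le> Lmax"
    \<comment> \<open>Assumption 3\<close>
    and essentially_cyclic: "\<And>k i. k \<ge> 1 \<Longrightarrow> \<exists>m\<in>{k..<k + T}. b m = i"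
    \<comment> \<open>parameter choice\<close>
    and \<alpha>_choice: "\<And>k. k \<ge> 1 \<Longrightarrow> \<alpha> k = 1 / (2 * L k)"
    and L0_pos: "\<And>i. L0 i > 0"
    and \<delta>_range: "0 \<le> \<delta>" "\<delta> < 1"
    and \<omega>_choice: "\<And>i j. j \<ge> 1 \<Longrightarrow>
          \<omega> (update_iter b i j)
            \<le> \<delta> / 6 * sqrt (at_update b L L0 i (j - 1) / at_update b L L0 i j)"
    and F_decreasing: "\<And>k. k \<ge> 1 \<Longrightarrow> F (x k) \<le> F (x (k - 1))"
    \<comment> \<open>the limit point\<close>
    and limit_point: "\<exists>\<sigma>. strict_mono \<sigma> \<and> (x \<circ> \<sigma>) \<longlonglongrightarrow> xbar"
    and KL: "KL_property F xbar \<rho> \<eta> \<theta>"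
    and local_lipschitz: "\<And>i. \<exists>K. K-lipschitz_on (ball xbar (4 * \<rho>))
                                (\<lambda>z. block_proj p i (gradf z))"
  shows "(\<theta> \<in> {0..1/2} \<longrightarrow>
            (\<exists>C>0. \<exists>a. 0 \<le> a \<and> a < 1 \<and> (\<forall>k\<ge>1. norm (x k - xbar) \<le> C * a ^ k)))
       \<and> (\<theta> \<in> {1/2<..<1} \<longrightarrow>
            (\<exists>C>0. \<forall>k\<ge>1. norm (x k - xbar)
                     \<le> C * real k powr (- ((1 - \<theta>) / (2 * \<theta> - 1)))))"
proof -
  interpret bpl_kl p f gradf r x b \<omega> \<alpha> L L0 Lmin Lmax \<delta> T xbar \<rho> \<eta> \<theta>
    by unfold_locales
      (fact f_grad f_C1 r_proper r_lsc F_bounded_below[unfolded F_def] bpl \<omega>_range block_lipschitz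
        L_bounds essentially_cyclic \<alpha>_choice L0_pos \<delta>_range \<omega>_choice F_decreasing[unfolded F_def]
        limit_point KL[unfolded F_def] local_lipschitz)+
  obtain \<Phi> c k0 where desc: "kl_descent x xbar \<Phi> q decrease_const c \<rho> (max \<theta> (1 / 2)) k0 T"
    by (rule kl_descent_exists)
  then interpret kl_descent x xbar \<Phi> q decrease_const c \<rho> "max \<theta> (1 / 2)" k0 T .
  show ?thesis
  proof (intro conjI impI)
    \<comment> \<open>All these exponents have been raised to \<open>1 / 2\<close>, where the linear
      rate holds.\<close>
    assume "\<theta> \<in> {0..1/2}"
    then show "\<exists>C>0. \<exists>a. 0 \<le> a \<and> a < 1 \<and> (\<forall>k\<ge>1. norm (x k - xbar) \<le> C * a ^ k)"
      using linear_rate by (simp add: dist_norm max_absorb2)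
  next
    assume "\<theta> \<in> {1/2<..<1}"
    then show "\<exists>C>0. \<forall>k\<ge>1. norm (x k - xbar) \<le> C * real k powr (- ((1 - \<theta>) / (2 * \<theta> - 1)))"
      using sublinear_rate by (simp add: dist_norm max_absorb1)
  qed
qed

end
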